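(* Let $n\ge1$, $m_1,\dots,m_n\ge1$ be integers and let $G=\mathbb{Z}_{m_1}\times\cdots\times\mathbb{Z}_{m_n}$ with $g_i$ a fixed generator of the factor $\mathbb{Z}_{m_i}$ (multiplicative notation). Let $(B_\bullet,\partial_\bullet)$ be the normalized bar resolution of $G$ and $(K_\bullet,d)$ the tensor resolution defined in the context. Define $\mathbb{Z}G$-module morphisms $F_m:B_m\to K_m$, $m=1,2,3$, as follows, for $0\le i_l,j_l,k_l<m_l$ $(1\le l\le n)$: $$F_1\big([g_1^{i_1}\cdots g_n^{i_n}]\big)=\sum_{s=1}^n\sum_{\alpha_s=0}^{i_s-1}g_1^{i_1}\cdots g_{s-1}^{i_{s-1}}g_s^{\alpha_s}\Phi_s;$$ $$F_2\big([g_1^{i_1}\cdots g_n^{i_n},g_1^{j_1}\cdots g_n^{j_n}]\big)=\sum_{s=1}^n g_1^{i_1+j_1}\cdots g_{s-1}^{i_{s-1}+j_{s-1}}\Big[\frac{i_s+j_s}{m_s}\Big]\Phi_{s,s}-\sum_{1\le s<t\le n}\sum_{\alpha_s=0}^{j_s-1}\sum_{\beta_t=0}^{i_t-1}g_1^{i_1}\cdots g_{t-1}^{i_{t-1}}g_1^{j_1}\cdots g_{s-1}^{j_{s-1}}g_s^{\alpha_s}g_t^{\beta_t}\Phi_{s,t};$$ \begin{align*} F_3\big([g_1^{i_1}\cdots g_n^{i_n},\,&g_1^{j_1}\cdots g_n^{j_n},\,g_1^{k_1}\cdots g_n^{k_n}]\big)=\\ &\sum_{r=1}^n\Big[\frac{j_r+k_r}{m_r}\Big]g_1^{j_1+k_1}\cdots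 g_{r-1}^{j_{r-1}+k_{r-1}}\sum_{\beta_r=0}^{i_r-1}g_1^{i_1}\cdots g_{r-1}^{i_{r-1}}g_r^{\beta_r}\Phi_{r,r,r}\\ &+\sum_{1\le r<t\le n}\Big[\frac{j_r+k_r}{m_r}\Big]g_1^{j_1+k_1}\cdots g_{r-1}^{j_{r-1}+k_{r-1}}\sum_{\beta_t=0}^{i_t-1}g_1^{i_1}\cdots g_{t-1}^{i_{t-1}}g_t^{\beta_t}\Phi_{r,r,t}\\ &+\sum_{1\le r<t\le n}\Big[\frac{i_t+j_t}{m_t}\Big]g_1^{i_1+j_1}\cdots g_{t-1}^{i_{t-1}+j_{t-1}}\sum_{\gamma_r=0}^{k_r-1}g_1^{k_1}\cdots g_{r-1}^{k_{r-1}}g_r^{\gamma_r}\Phi_{r,t,t}\\ &-\sum_{1\le r<s<t\le n}\ \sum_{\beta_t=0}^{i_t-1}g_1^{i_1}\cdots g_{t-1}^{i_{t-1}}g_t^{\beta_t}\sum_{\alpha_s=0}^{j_s-1}g_1^{j_1}\cdots g_{s-1}^{j_{s-1}}g_s^{\alpha_s}\sum_{\gamma_r=0}^{k_r-1}g_1^{k_1}\cdots g_{r-1}^{k_{r-1}}g_r^{\gamma_r}\Phi_{r,s,t}. \end{align*} Then, identifying $B_0=\mathbb{Z}G[\,]$ with $K_0=\mathbb{Z}G\,\Phi(0,\dots,0)$ via $[\,]\mapsto\Phi(0,\dots,0)$ (both augmented to $\mathbb{Z}$ by sending this generator to $1$), the maps $F_1,F_2,F_3$ form a chain map up to degree $3$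 from $(B_\bullet,\partial_\bullet)$ to $(K_\bullet,d)$ over the identity of $\mathbb{Z}$, i.e. $$dF_1=\partial_1,\qquad dF_2=F_1\partial_2,\qquad dF_3=F_2\partial_3.$$
   Context: Normalized bar resolution: $B_m$ is the free $\mathbb{Z}G$-module generated by the symbols $[h_1,\dots,h_m]$, $h_i\in G$, with the convention that a symbol is $0$ if some $h_i=1$; $B_0$ is free on $[\,]$; the differentials are $\partial_1[h]=(h-1)[\,]$, $\partial_2[h_1,h_2]=h_1[h_2]-[h_1h_2]+[h_1]$, $\partial_3[h_1,h_2,h_3]=h_1[h_2,h_3]-[h_1h_2,h_3]+[h_1,h_2h_3]-[h_1,h_2]$. Tensor resolution: for each sequence of nonnegative integers $a_1,\dots,a_n$ let $\Phi(a_1,\dots,a_n)$ be a free generator in degree $a_1+\cdots+a_n$, and $K_m=\bigoplus_{a_1+\cdots+a_n=m}(\mathbb{Z}G)\Phi(a_1,\dots,a_n)$. Put $T_i=g_i-1$ and $N_i=\sum_{j=0}^{m_i-1}g_i^j$ in $\mathbb{Z}G$. The differential is $d=d_1+\cdots+d_n$, where $d_i(\Phi(a_1,\dots,a_n))$ equals $0$ if $a_i=0$; $(-1)^{\sum_{l<i}a_l}N_i\Phi(a_1,\dots,a_i-1,\dots,a_n)$ if $a_i\neq0$ is even; and $(-1)^{\sum_{l<i}a_l}T_i\Phi(a_1,\dots,a_i-1,\dots,a_n)$ if $a_i$ is odd. For $i_1\le i_2\le\cdots\le i_p$, $\Phi_{i_1,\dots,i_p}$ denotes $\Phi(a_1,\dots,a_n)$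 with $a_l$ the number of occurrences of $l$ among $i_1,\dots,i_p$ (e.g. $\Phi_{i,i}$ has a $2$ in position $i$ and $0$ elsewhere). $[\frac{s}{t}]$ (of numbers) denotes the integer part of $\frac{s}{t}$; empty sums are $0$ and empty products are $1$. *)

theory Defs
  imports "HOL-Algebra.Product_Groups" "HOL-Algebra.Elementary_Groups" "HOL-Algebra.Module"
    "HOL-Library.Poly_Mapping"
begin

section \<open>The integral group ring and free modules over it\<close>

text \<open>
  Elements of \<open>\<int>G\<close> are finitely supported functions \<open>'a \<Rightarrow>\<^sub>0 int\<close>. The multiplication that
  \<^theory>\<open>HOL-Library.Poly_Mapping\<close> provides is the convolution over a type class monoid; here the
  convolution is over the monoid record \<open>G\<close>. The additions of the ring and module records below
  are those of the types, so that the big operator \<open>\<Sum>\<close> of the types can be used for them.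
  A group element \<open>h\<close> as an element of \<open>\<int>G\<close> is \<^term>\<open>frag_of h\<close>.
\<close>

definition zg_mult ::
  "('a, 'c) monoid_scheme \<Rightarrow> ('a \<Rightarrow>\<^sub>0 int) \<Rightarrow> ('a \<Rightarrow>\<^sub>0 int) \<Rightarrow> ('a \<Rightarrow>\<^sub>0 int)" where
  "zg_mult G x y =
     (\<Sum>a \<in> Poly_Mapping.keys x. \<Sum>b \<in> Poly_Mapping.keys y.
        Poly_Mapping.single (a \<otimes>\<^bsub>G\<^esub> b) (Poly_Mapping.lookup x a * Poly_Mapping.lookup y b))"

definition group_ring :: "('a, 'c) monoid_scheme \<Rightarrow> ('a \<Rightarrow>\<^sub>0 int) ring" where
  "group_ring G =
     \<lparr>carrier = {x. Poly_Mapping.keys x \<subseteq> carrier G},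
      monoid.mult = zg_mult G,
      one = frag_of \<one>\<^bsub>G\<^esub>,
      zero = 0,
      add = (+)\<rparr>"

definition zg_smult ::
  "('a, 'c) monoid_scheme \<Rightarrow> ('a \<Rightarrow>\<^sub>0 int) \<Rightarrow> ('b \<Rightarrow>\<^sub>0 ('a \<Rightarrow>\<^sub>0 int)) \<Rightarrow> ('b \<Rightarrow>\<^sub>0 ('a \<Rightarrow>\<^sub>0 int))"
    (infixr \<open>\<bullet>\<index>\<close> 75) where
  "zg_smult G r v = Poly_Mapping.map (\<lambda>c. r \<otimes>\<^bsub>group_ring G\<^esub> c) v"

text \<open>
  The free \<open>\<int>G\<close>-module on a set \<open>S\<close>. The record type of modules inherits the fields
  \<open>mult\<close> and \<open>one\<close> from that of rings; they play no role for modules.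
\<close>

definition free_zg_module ::
  "('a, 'c) monoid_scheme \<Rightarrow> 'b set \<Rightarrow> ('a \<Rightarrow>\<^sub>0 int, 'b \<Rightarrow>\<^sub>0 ('a \<Rightarrow>\<^sub>0 int)) module" where
  "free_zg_module G S =
     \<lparr>carrier = {v. Poly_Mapping.keys v \<subseteq> S \<and>
                    (\<forall>b. Poly_Mapping.lookup v b \<in> carrier (group_ring G))},
      monoid.mult = (\<lambda>_ _. 0),
      one = 0,
      zero = 0,
      add = (+),
      smult = zg_smult G\<rparr>"

lemma zg_mult_superset:
  assumes "finite A" "Poly_Mapping.keys x \<subseteq> A" "finite B" "Poly_Mapping.keys y \<subseteq> B"
  shows "zg_mult G x y =
     (\<Sum>a\<in>A. \<Sum>b\<in>B.
        Poly_Mapping.single (a \<otimes>\<^bsub>G\<^esub> b) (Poly_Mapping.lookup x a * Poly_Mapping.lookup y b))"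
proof -
  have "(\<Sum>b\<in>B. Poly_Mapping.single (a \<otimes>\<^bsub>G\<^esub> b) (Poly_Mapping.lookup x a * Poly_Mapping.lookup y b)) =
        (\<Sum>b\<in>Poly_Mapping.keys y.
          Poly_Mapping.single (a \<otimes>\<^bsub>G\<^esub> b) (Poly_Mapping.lookup x a * Poly_Mapping.lookup y b))" for a
    by (rule sum.mono_neutral_right) (use assms in \<open>auto simp: in_keys_iff\<close>)
  then show ?thesis
    unfolding zg_mult_def
    by simp (rule sum.mono_neutral_left, use assms in \<open>auto simp: in_keys_iff\<close>)
qed

lemma zg_mult_add_left: "zg_mult G (x + y) z = zg_mult G x z + zg_mult G y z"
proof -
  let ?A = "Poly_Mapping.keys x \<union> Poly_Mapping.keys y" and ?B = "Poly_Mapping.keys z"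
  have "zg_mult G w z = (\<Sum>a\<in>?A. \<Sum>b\<in>?B.
      Poly_Mapping.single (a \<otimes>\<^bsub>G\<^esub> b) (Poly_Mapping.lookup w a * Poly_Mapping.lookup z b))"
    if "Poly_Mapping.keys w \<subseteq> ?A" for w
    by (rule zg_mult_superset) (use that in auto)
  then show ?thesis
    using Poly_Mapping.keys_add[of x y]
    by (simp add: lookup_add distrib_right single_add sum.distrib)
qed

lemma zg_mult_add_right: "zg_mult G x (y + z) = zg_mult G x y + zg_mult G x z"
proof -
  let ?A = "Poly_Mapping.keys x" and ?B = "Poly_Mapping.keys y \<union> Poly_Mapping.keys z"
  have "zg_mult G x w = (\<Sum>a\<in>?A. \<Sum>b\<in>?B.
      Poly_Mapping.single (a \<otimes>\<^bsub>G\<^esub> b) (Poly_Mapping.lookup x a * Poly_Mapping.lookup w b))"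
    if "Poly_Mapping.keys w \<subseteq> ?B" for w
    by (rule zg_mult_superset) (use that in auto)
  then show ?thesis
    using Poly_Mapping.keys_add[of y z]
    by (simp add: lookup_add distrib_left single_add sum.distrib)
qed

lemma zg_mult_0 [simp]: "zg_mult G 0 x = 0" "zg_mult G x 0 = 0"
  by (simp_all add: zg_mult_def)

lemma zg_mult_single:
  "zg_mult G (Poly_Mapping.single a c) (Poly_Mapping.single b d) =
   Poly_Mapping.single (a \<otimes>\<^bsub>G\<^esub> b) (c * d)"
  by (subst zg_mult_superset[of "{a}" _ "{b}"]) (auto simp: lookup_single)

lemma group_ring_induct [consumes 1, case_names zero single_add]:
  assumes "x \<in> carrier (group_ring G)"
    and "P 0"
    and "\<And>a c y. a \<in> carrier G \<Longrightarrow> y \<in> carrier (group_ring G) \<Longrightarrow> P y \<Longrightarrow>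
           P (Poly_Mapping.single a c + y)"
  shows "P x"
proof -
  have "finite (Poly_Mapping.keys x)" by simp
  then show ?thesis using assms(1)
  proof (induction "Poly_Mapping.keys x" arbitrary: x rule: finite_induct)
    case empty
    then show ?case using assms(2) by (metis keys_eq_empty)
  next
    case (insert a A)
    define y where "y = x - Poly_Mapping.single a (Poly_Mapping.lookup x a)"
    have "A = Poly_Mapping.keys y"
      using insert(2,4) by (auto simp: y_def in_keys_iff lookup_minus lookup_single when_def set_eq_iff split: if_splits)
    moreover have "y \<in> carrier (group_ring G)"
      using insert(4,5) calculation by (auto simp: group_ring_def)
    ultimately have "P y" "y \<in> carrier (group_ring G)" "a \<in> carrier G"
      using insert by (auto simp: group_ring_def)
    then have "P (Poly_Mapping.single a (Poly_Mapping.lookup x a) + y)"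
      using assms(3) by blast
    then show ?case by (simp add: y_def)
  qed
qed

lemma zg_mult_closed:
  assumes "monoid G" "x \<in> carrier (group_ring G)" "y \<in> carrier (group_ring G)"
  shows "zg_mult G x y \<in> carrier (group_ring G)"
proof -
  interpret monoid G by fact
  have add: "u + v \<in> carrier (group_ring G)"
    if "u \<in> carrier (group_ring G)" "v \<in> carrier (group_ring G)" for u v
    using that Poly_Mapping.keys_add[of u v] by (auto simp: group_ring_def)
  have z: "0 \<in> carrier (group_ring G)" by (simp add: group_ring_def)
  have single: "zg_mult G (Poly_Mapping.single a c) y \<in> carrier (group_ring G)"
    if "a \<in> carrier G" for a c
    using assms(3)
  proof (induction y rule: group_ring_induct)
    case zero
    then show ?case using z by simp
  next
    case (single_add b d y)
    have "Poly_Mapping.single (a \<otimes>\<^bsub>G\<^esub> b) (c * d) \<in> carrier (group_ring G)"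
      using that single_add(1) by (auto simp: group_ring_def)
    then show ?case using single_add add by (simp add: zg_mult_add_right zg_mult_single)
  qed
  show ?thesis
    using assms(2)
    by (induction x rule: group_ring_induct) (use z add single in \<open>simp_all add: zg_mult_add_left\<close>)
qed

lemma zg_mult_comm:
  assumes "comm_monoid G" "x \<in> carrier (group_ring G)" "y \<in> carrier (group_ring G)"
  shows "zg_mult G x y = zg_mult G y x"
proof -
  interpret comm_monoid G by fact
  have "zg_mult G x y =
     (\<Sum>b\<in>Poly_Mapping.keys y. \<Sum>a\<in>Poly_Mapping.keys x.
        Poly_Mapping.single (a \<otimes>\<^bsub>G\<^esub> b) (Poly_Mapping.lookup x a * Poly_Mapping.lookup y b))"
    unfolding zg_mult_def by (rule sum.swap)
  also have "\<dots> = zg_mult G y x"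
    unfolding zg_mult_def
    using assms(2,3) by (intro sum.cong refl) (auto simp: m_comm mult.commute group_ring_def subset_iff)
  finally show ?thesis .
qed

lemma zg_mult_assoc:
  assumes "monoid G" "x \<in> carrier (group_ring G)" "y \<in> carrier (group_ring G)"
    "z \<in> carrier (group_ring G)"
  shows "zg_mult G (zg_mult G x y) z = zg_mult G x (zg_mult G y z)"
proof -
  interpret monoid G by fact
  have s2: "zg_mult G (zg_mult G (Poly_Mapping.single a c) (Poly_Mapping.single b d)) z =
            zg_mult G (Poly_Mapping.single a c) (zg_mult G (Poly_Mapping.single b d) z)"
    if "a \<in> carrier G" "b \<in> carrier G" for a b c d
    using assms(4) that
    by (induction z rule: group_ring_induct)
       (simp_all add: zg_mult_add_right zg_mult_single m_assoc mult.assoc)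
  have s1: "zg_mult G (zg_mult G (Poly_Mapping.single a c) y) z =
            zg_mult G (Poly_Mapping.single a c) (zg_mult G y z)"
    if "a \<in> carrier G" for a c
    using assms(3) that
    by (induction y rule: group_ring_induct) (simp_all add: zg_mult_add_left zg_mult_add_right s2)
  show ?thesis
    using assms(2)
    by (induction x rule: group_ring_induct) (simp_all add: zg_mult_add_left s1)
qed

lemma zg_mult_one_left:
  assumes "monoid G" "x \<in> carrier (group_ring G)"
  shows "zg_mult G (frag_of \<one>\<^bsub>G\<^esub>) x = x"
proof -
  interpret monoid G by fact
  show ?thesis
    using assms(2)
    by (induction x rule: group_ring_induct) (simp_all add: zg_mult_add_right zg_mult_single)
qed

lemma cring_group_ring:
  assumes "comm_group G"
  shows "cring (group_ring G)"
proof -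
  interpret comm_group G by fact
  have cm: "comm_monoid G" and mo: "monoid G" by unfold_locales
  have "abelian_group (group_ring G)"
  proof (rule abelian_groupI)
    fix x y assume "x \<in> carrier (group_ring G)" "y \<in> carrier (group_ring G)"
    then show "x \<oplus>\<^bsub>group_ring G\<^esub> y \<in> carrier (group_ring G)"
      using Poly_Mapping.keys_add[of x y] by (auto simp: group_ring_def)
  next
    fix x assume "x \<in> carrier (group_ring G)"
    then show "\<exists>y\<in>carrier (group_ring G). y \<oplus>\<^bsub>group_ring G\<^esub> x = \<zero>\<^bsub>group_ring G\<^esub>"
      by (intro bexI[of _ "- x"]) (auto simp: group_ring_def)
  qed (auto simp: group_ring_def ac_simps)
  moreover have "Group.comm_monoid (group_ring G)"
  proof (rule comm_monoidI)
    show "\<one>\<^bsub>group_ring G\<^esub> \<in> carrier (group_ring G)" by (simp add: group_ring_def)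
  qed (use zg_mult_closed[OF mo] zg_mult_assoc[OF mo] zg_mult_comm[OF cm] zg_mult_one_left[OF mo]
        in \<open>auto simp: group_ring_def\<close>)
  ultimately show ?thesis
    by (rule cringI) (simp add: group_ring_def zg_mult_add_left)
qed

lemma lookup_zg_smult [simp]:
  "Poly_Mapping.lookup (r \<bullet>\<^bsub>G\<^esub> v) b = zg_mult G r (Poly_Mapping.lookup v b)"
  by (simp add: zg_smult_def Poly_Mapping.map.rep_eq when_def group_ring_def)

lemma module_free_zg_module:
  assumes "comm_group G"
  shows "module (group_ring G) (free_zg_module G (S :: 'b set))"
proof (rule moduleI)
  interpret comm_group G by fact
  have mo: "monoid G" by unfold_locales
  show "cring (group_ring G)" by (rule cring_group_ring) fact
  then interpret R: cring "group_ring G" .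
  have add: "u + v \<in> carrier (group_ring G)"
    if "u \<in> carrier (group_ring G)" "v \<in> carrier (group_ring G)" for u v
    using R.a_closed[OF that] by (simp add: group_ring_def)
  have z: "0 \<in> carrier (group_ring G)" by (simp add: group_ring_def)
  show "abelian_group (free_zg_module G S)"
  proof (rule abelian_groupI)
    fix x y assume "x \<in> carrier (free_zg_module G S)" "y \<in> carrier (free_zg_module G S)"
    then show "x \<oplus>\<^bsub>free_zg_module G S\<^esub> y \<in> carrier (free_zg_module G S)"
      using Poly_Mapping.keys_add[of x y] by (auto simp: free_zg_module_def lookup_add add)
  next
    fix x assume "x \<in> carrier (free_zg_module G S)"
    then show "\<exists>y\<in>carrier (free_zg_module G S).
                 y \<oplus>\<^bsub>free_zg_module G S\<^esub> x = \<zero>\<^bsub>free_zg_module G S\<^esub>"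
      by (intro bexI[of _ "- x"]) (auto simp: free_zg_module_def group_ring_def)
  qed (auto simp: free_zg_module_def z ac_simps)
  have keys: "Poly_Mapping.keys (r \<bullet>\<^bsub>G\<^esub> v) \<subseteq> Poly_Mapping.keys v" for r and v :: "'b \<Rightarrow>\<^sub>0 ('a \<Rightarrow>\<^sub>0 int)"
    by (auto simp: in_keys_iff)
  fix a x assume "a \<in> carrier (group_ring G)" "x \<in> carrier (free_zg_module G S)"
  then show "a \<odot>\<^bsub>free_zg_module G S\<^esub> x \<in> carrier (free_zg_module G S)"
    using keys[of a x] by (auto simp: free_zg_module_def zg_mult_closed[OF mo])
next
  have mo: "monoid G" using assms by (simp add: comm_group_def group_def)
  fix a b x assume *: "a \<in> carrier (group_ring G)" "b \<in> carrier (group_ring G)"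
    "x \<in> carrier (free_zg_module G S)"
  have "(zg_mult G a b) \<bullet>\<^bsub>G\<^esub> x = a \<bullet>\<^bsub>G\<^esub> b \<bullet>\<^bsub>G\<^esub> x"
    by (rule poly_mapping_eqI) (use * in \<open>simp add: free_zg_module_def zg_mult_assoc[OF mo]\<close>)
  then show "(a \<otimes>\<^bsub>group_ring G\<^esub> b) \<odot>\<^bsub>free_zg_module G S\<^esub> x =
             a \<odot>\<^bsub>free_zg_module G S\<^esub> (b \<odot>\<^bsub>free_zg_module G S\<^esub> x)"
    by (simp add: free_zg_module_def group_ring_def)
next
  have mo: "monoid G" using assms by (simp add: comm_group_def group_def)
  fix x assume "x \<in> carrier (free_zg_module G S)"
  then have "frag_of \<one>\<^bsub>G\<^esub> \<bullet>\<^bsub>G\<^esub> x = x"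
    by (intro poly_mapping_eqI) (simp add: free_zg_module_def zg_mult_one_left[OF mo])
  then show "\<one>\<^bsub>group_ring G\<^esub> \<odot>\<^bsub>free_zg_module G S\<^esub> x = x"
    by (simp add: free_zg_module_def group_ring_def)
qed (auto intro!: poly_mapping_eqI
       simp: free_zg_module_def group_ring_def lookup_add zg_mult_add_left zg_mult_add_right)

definition module_hom ::
  "('r, 'c) ring_scheme \<Rightarrow> ('r, 'a, 'd) module_scheme \<Rightarrow> ('r, 'b, 'e) module_scheme \<Rightarrow> ('a \<Rightarrow> 'b) set"
  where
  "module_hom R M N =
     {f \<in> carrier M \<rightarrow> carrier N.
        (\<forall>x \<in> carrier M. \<forall>y \<in> carrier M. f (x \<oplus>\<^bsub>M\<^esub> y) = f x \<oplus>\<^bsub>N\<^esub> f y) \<and>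
        (\<forall>r \<in> carrier R. \<forall>x \<in> carrier M. f (r \<odot>\<^bsub>M\<^esub> x) = r \<odot>\<^bsub>N\<^esub> f x)}"

text \<open>The \<open>\<int>G\<close>-linear extension of a function \<open>f\<close> on the free generators.\<close>

definition zg_linear ::
  "('a, 'c) monoid_scheme \<Rightarrow> ('b \<Rightarrow> ('d \<Rightarrow>\<^sub>0 ('a \<Rightarrow>\<^sub>0 int))) \<Rightarrow>
   ('b \<Rightarrow>\<^sub>0 ('a \<Rightarrow>\<^sub>0 int)) \<Rightarrow> ('d \<Rightarrow>\<^sub>0 ('a \<Rightarrow>\<^sub>0 int))" where
  "zg_linear G f v = (\<Sum>b \<in> Poly_Mapping.keys v. Poly_Mapping.lookup v b \<bullet>\<^bsub>G\<^esub> f b)"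

text \<open>The \<open>\<int>G\<close>-linear map to the trivial module \<open>\<int>\<close> that sends every free generator to \<open>1\<close>.\<close>

definition augmentation :: "('b \<Rightarrow>\<^sub>0 ('a \<Rightarrow>\<^sub>0 int)) \<Rightarrow> int" where
  "augmentation v =
     (\<Sum>b \<in> Poly_Mapping.keys v. \<Sum>h \<in> Poly_Mapping.keys (Poly_Mapping.lookup v b).
        Poly_Mapping.lookup (Poly_Mapping.lookup v b) h)"


section \<open>The normalized bar resolution\<close>

definition bar_module ::
  "('a, 'c) monoid_scheme \<Rightarrow> nat \<Rightarrow> ('a \<Rightarrow>\<^sub>0 int, 'a list \<Rightarrow>\<^sub>0 ('a \<Rightarrow>\<^sub>0 int)) module" where
  "bar_module G p =
     free_zg_module G {hs. length hs = p \<and> set hs \<subseteq> carrier G - {\<one>\<^bsub>G\<^esub>}}"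

definition bar :: "('a, 'c) monoid_scheme \<Rightarrow> 'a list \<Rightarrow> ('a list \<Rightarrow>\<^sub>0 ('a \<Rightarrow>\<^sub>0 int))" where
  "bar G hs = (if \<one>\<^bsub>G\<^esub> \<in> set hs then 0 else Poly_Mapping.single hs \<one>\<^bsub>group_ring G\<^esub>)"

definition bar_d1 ::
  "('a, 'c) monoid_scheme \<Rightarrow> ('a list \<Rightarrow>\<^sub>0 ('a \<Rightarrow>\<^sub>0 int)) \<Rightarrow> ('a list \<Rightarrow>\<^sub>0 ('a \<Rightarrow>\<^sub>0 int))" where
  "bar_d1 G = zg_linear G (\<lambda>hs. (frag_of (hs ! 0) - frag_of \<one>\<^bsub>G\<^esub>) \<bullet>\<^bsub>G\<^esub> bar G [])"

definition bar_d2 ::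
  "('a, 'c) monoid_scheme \<Rightarrow> ('a list \<Rightarrow>\<^sub>0 ('a \<Rightarrow>\<^sub>0 int)) \<Rightarrow> ('a list \<Rightarrow>\<^sub>0 ('a \<Rightarrow>\<^sub>0 int))" where
  "bar_d2 G = zg_linear G (\<lambda>hs.
     frag_of (hs ! 0) \<bullet>\<^bsub>G\<^esub> bar G [hs ! 1]
     - bar G [hs ! 0 \<otimes>\<^bsub>G\<^esub> hs ! 1]
     + bar G [hs ! 0])"

definition bar_d3 ::
  "('a, 'c) monoid_scheme \<Rightarrow> ('a list \<Rightarrow>\<^sub>0 ('a \<Rightarrow>\<^sub>0 int)) \<Rightarrow> ('a list \<Rightarrow>\<^sub>0 ('a \<Rightarrow>\<^sub>0 int))" where
  "bar_d3 G = zg_linear G (\<lambda>hs.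
     frag_of (hs ! 0) \<bullet>\<^bsub>G\<^esub> bar G [hs ! 1, hs ! 2]
     - bar G [hs ! 0 \<otimes>\<^bsub>G\<^esub> hs ! 1, hs ! 2]
     + bar G [hs ! 0, hs ! 1 \<otimes>\<^bsub>G\<^esub> hs ! 2]
     - bar G [hs ! 0, hs ! 1])"


section \<open>The tensor resolution\<close>

text \<open>
  A sequence \<open>a\<^sub>1, \<dots>, a\<^sub>n\<close> is a function \<open>nat \<Rightarrow> nat\<close> that vanishes outside \<open>{1..n}\<close>.
  In this section \<open>g l\<close> is the generator \<open>g\<^sub>l\<close>, as an element of \<open>G\<close>.
\<close>

definition tensor_module ::
  "('a, 'c) monoid_scheme \<Rightarrow> nat \<Rightarrow> nat \<Rightarrow> ('a \<Rightarrow>\<^sub>0 int, (nat \<Rightarrow> nat) \<Rightarrow>\<^sub>0 ('a \<Rightarrow>\<^sub>0 int)) module"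
  where
  "tensor_module G n p =
     free_zg_module G {a. (\<forall>l. l \<notin> {1..n} \<longrightarrow> a l = 0) \<and> (\<Sum>l=1..n. a l) = p}"

definition Phi_seq ::
  "('a, 'c) monoid_scheme \<Rightarrow> (nat \<Rightarrow> nat) \<Rightarrow> ((nat \<Rightarrow> nat) \<Rightarrow>\<^sub>0 ('a \<Rightarrow>\<^sub>0 int))" where
  "Phi_seq G a = Poly_Mapping.single a \<one>\<^bsub>group_ring G\<^esub>"

text \<open>\<open>Phi G [i\<^sub>1, \<dots>, i\<^sub>p]\<close> is the generator with lower indices \<open>i\<^sub>1, \<dots>, i\<^sub>p\<close>.\<close>

definition Phi ::
  "('a, 'c) monoid_scheme \<Rightarrow> nat list \<Rightarrow> ((nat \<Rightarrow> nat) \<Rightarrow>\<^sub>0 ('a \<Rightarrow>\<^sub>0 int))" where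
  "Phi G is = Phi_seq G (count_list is)"

definition T_elt :: "('a, 'c) monoid_scheme \<Rightarrow> (nat \<Rightarrow> 'a) \<Rightarrow> nat \<Rightarrow> ('a \<Rightarrow>\<^sub>0 int)" where
  "T_elt G g i = frag_of (g i) - frag_of \<one>\<^bsub>G\<^esub>"

definition N_elt ::
  "('a, 'c) monoid_scheme \<Rightarrow> (nat \<Rightarrow> nat) \<Rightarrow> (nat \<Rightarrow> 'a) \<Rightarrow> nat \<Rightarrow> ('a \<Rightarrow>\<^sub>0 int)" where
  "N_elt G m g i = (\<Sum>j<m i. frag_of (g i [^]\<^bsub>G\<^esub> j))"

definition tensor_d_part ::
  "('a, 'c) monoid_scheme \<Rightarrow> (nat \<Rightarrow> nat) \<Rightarrow> (nat \<Rightarrow> 'a) \<Rightarrow> nat \<Rightarrow>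
   (nat \<Rightarrow> nat) \<Rightarrow> ((nat \<Rightarrow> nat) \<Rightarrow>\<^sub>0 ('a \<Rightarrow>\<^sub>0 int))" where
  "tensor_d_part G m g i a =
     (if a i = 0 then 0
      else Poly_Mapping.single \<one>\<^bsub>G\<^esub> ((-1) ^ (\<Sum>l\<in>{1..<i}. a l)) \<bullet>\<^bsub>G\<^esub>
           (if even (a i) then N_elt G m g i else T_elt G g i) \<bullet>\<^bsub>G\<^esub>
           Phi_seq G (a(i := a i - 1)))"

definition tensor_d ::
  "('a, 'c) monoid_scheme \<Rightarrow> nat \<Rightarrow> (nat \<Rightarrow> nat) \<Rightarrow> (nat \<Rightarrow> 'a) \<Rightarrow>
   ((nat \<Rightarrow> nat) \<Rightarrow>\<^sub>0 ('a \<Rightarrow>\<^sub>0 int)) \<Rightarrow> ((nat \<Rightarrow> nat) \<Rightarrow>\<^sub>0 ('a \<Rightarrow>\<^sub>0 int))" where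
  "tensor_d G n m g v = (\<Sum>i=1..n. zg_linear G (tensor_d_part G m g i) v)"


section \<open>The comparison maps\<close>

text \<open>\<open>gmon G g p e\<close> is \<open>g\<^sub>1 ^ e\<^sub>1 \<cdots> g\<^sub>p ^ e\<^sub>p\<close>; a prefix up to \<open>s - 1\<close> is the empty product if \<open>s = 1\<close>.\<close>

definition gmon :: "('a, 'c) monoid_scheme \<Rightarrow> (nat \<Rightarrow> 'a) \<Rightarrow> nat \<Rightarrow> (nat \<Rightarrow> nat) \<Rightarrow> 'a" where
  "gmon G g p e = finprod G (\<lambda>l. g l [^]\<^bsub>G\<^esub> e l) {1..p}"

definition exponents :: "nat \<Rightarrow> (nat \<Rightarrow> nat) \<Rightarrow> (nat \<Rightarrow> nat) set" where
  "exponents n m = {e. \<forall>l\<in>{1..n}. e l < m l}"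

definition F1_value ::
  "('a, 'c) monoid_scheme \<Rightarrow> nat \<Rightarrow> (nat \<Rightarrow> 'a) \<Rightarrow> (nat \<Rightarrow> nat) \<Rightarrow>
   ((nat \<Rightarrow> nat) \<Rightarrow>\<^sub>0 ('a \<Rightarrow>\<^sub>0 int))" where
  "F1_value G n g i =
     (\<Sum>s=1..n. \<Sum>\<alpha><i s. frag_of (gmon G g (s - 1) i \<otimes>\<^bsub>G\<^esub> g s [^]\<^bsub>G\<^esub> \<alpha>) \<bullet>\<^bsub>G\<^esub> Phi G [s])"

text \<open>
  An integer multiple \<open>c h\<close> of a group element \<open>h\<close> in \<open>\<int>G\<close> is \<^term>\<open>Poly_Mapping.single h c\<close>.
\<close>

definition F2_value ::
  "('a, 'c) monoid_scheme \<Rightarrow> nat \<Rightarrow> (nat \<Rightarrow> nat) \<Rightarrow> (nat \<Rightarrow> 'a) \<Rightarrow>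
   (nat \<Rightarrow> nat) \<Rightarrow> (nat \<Rightarrow> nat) \<Rightarrow> ((nat \<Rightarrow> nat) \<Rightarrow>\<^sub>0 ('a \<Rightarrow>\<^sub>0 int))" where
  "F2_value G n m g i j =
     (\<Sum>s=1..n. Poly_Mapping.single (gmon G g (s - 1) (\<lambda>l. i l + j l)) (int ((i s + j s) div m s))
                  \<bullet>\<^bsub>G\<^esub> Phi G [s, s])
     - (\<Sum>s=1..n. \<Sum>t\<in>{s<..n}. \<Sum>\<alpha><j s. \<Sum>\<beta><i t.
          frag_of (gmon G g (t - 1) i \<otimes>\<^bsub>G\<^esub> gmon G g (s - 1) j \<otimes>\<^bsub>G\<^esub> g s [^]\<^bsub>G\<^esub> \<alpha> \<otimes>\<^bsub>G\<^esub> g t [^]\<^bsub>G\<^esub> \<beta>)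
            \<bullet>\<^bsub>G\<^esub> Phi G [s, t])"

definition F3_value ::
  "('a, 'c) monoid_scheme \<Rightarrow> nat \<Rightarrow> (nat \<Rightarrow> nat) \<Rightarrow> (nat \<Rightarrow> 'a) \<Rightarrow>
   (nat \<Rightarrow> nat) \<Rightarrow> (nat \<Rightarrow> nat) \<Rightarrow> (nat \<Rightarrow> nat) \<Rightarrow> ((nat \<Rightarrow> nat) \<Rightarrow>\<^sub>0 ('a \<Rightarrow>\<^sub>0 int))" where
  "F3_value G n m g i j k =
     (\<Sum>r=1..n.
        Poly_Mapping.single (gmon G g (r - 1) (\<lambda>l. j l + k l)) (int ((j r + k r) div m r)) \<bullet>\<^bsub>G\<^esub>
        (\<Sum>\<beta><i r. frag_of (gmon G g (r - 1) i \<otimes>\<^bsub>G\<^esub> g r [^]\<^bsub>G\<^esub> \<beta>)) \<bullet>\<^bsub>G\<^esub> Phi G [r, r, r])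
     + (\<Sum>r=1..n. \<Sum>t\<in>{r<..n}.
        Poly_Mapping.single (gmon G g (r - 1) (\<lambda>l. j l + k l)) (int ((j r + k r) div m r)) \<bullet>\<^bsub>G\<^esub>
        (\<Sum>\<beta><i t. frag_of (gmon G g (t - 1) i \<otimes>\<^bsub>G\<^esub> g t [^]\<^bsub>G\<^esub> \<beta>)) \<bullet>\<^bsub>G\<^esub> Phi G [r, r, t])
     + (\<Sum>r=1..n. \<Sum>t\<in>{r<..n}.
        Poly_Mapping.single (gmon G g (t - 1) (\<lambda>l. i l + j l)) (int ((i t + j t) div m t)) \<bullet>\<^bsub>G\<^esub>
        (\<Sum>\<gamma><k r. frag_of (gmon G g (r - 1) k \<otimes>\<^bsub>G\<^esub> g r [^]\<^bsub>G\<^esub> \<gamma>)) \<bullet>\<^bsub>G\<^esub> Phi G [r, t, t])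
     - (\<Sum>r=1..n. \<Sum>s\<in>{r<..n}. \<Sum>t\<in>{s<..n}.
        (\<Sum>\<beta><i t. frag_of (gmon G g (t - 1) i \<otimes>\<^bsub>G\<^esub> g t [^]\<^bsub>G\<^esub> \<beta>)) \<bullet>\<^bsub>G\<^esub>
        (\<Sum>\<alpha><j s. frag_of (gmon G g (s - 1) j \<otimes>\<^bsub>G\<^esub> g s [^]\<^bsub>G\<^esub> \<alpha>)) \<bullet>\<^bsub>G\<^esub>
        (\<Sum>\<gamma><k r. frag_of (gmon G g (r - 1) k \<otimes>\<^bsub>G\<^esub> g r [^]\<^bsub>G\<^esub> \<gamma>)) \<bullet>\<^bsub>G\<^esub> Phi G [r, s, t])"

text \<open>
  The values are prescribed on all symbols, including those with an entry \<open>1\<close>, which are \<open>0\<close> in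
  the normalized bar resolution. The existence of such morphisms is therefore not automatic.
  \<open>F0\<close> is the identification of the modules in degree \<open>0\<close>.
\<close>

definition comparison_maps ::
  "('a, 'c) monoid_scheme \<Rightarrow> nat \<Rightarrow> (nat \<Rightarrow> nat) \<Rightarrow> (nat \<Rightarrow> 'a) \<Rightarrow>
   (('a list \<Rightarrow>\<^sub>0 ('a \<Rightarrow>\<^sub>0 int)) \<Rightarrow> ((nat \<Rightarrow> nat) \<Rightarrow>\<^sub>0 ('a \<Rightarrow>\<^sub>0 int))) \<Rightarrow>
   (('a list \<Rightarrow>\<^sub>0 ('a \<Rightarrow>\<^sub>0 int)) \<Rightarrow> ((nat \<Rightarrow> nat) \<Rightarrow>\<^sub>0 ('a \<Rightarrow>\<^sub>0 int))) \<Rightarrow>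
   (('a list \<Rightarrow>\<^sub>0 ('a \<Rightarrow>\<^sub>0 int)) \<Rightarrow> ((nat \<Rightarrow> nat) \<Rightarrow>\<^sub>0 ('a \<Rightarrow>\<^sub>0 int))) \<Rightarrow>
   (('a list \<Rightarrow>\<^sub>0 ('a \<Rightarrow>\<^sub>0 int)) \<Rightarrow> ((nat \<Rightarrow> nat) \<Rightarrow>\<^sub>0 ('a \<Rightarrow>\<^sub>0 int))) \<Rightarrow> bool" where
  "comparison_maps G n m g F0 F1 F2 F3 \<longleftrightarrow>
     F0 \<in> module_hom (group_ring G) (bar_module G 0) (tensor_module G n 0) \<and>
     F1 \<in> module_hom (group_ring G) (bar_module G 1) (tensor_module G n 1) \<and>
     F2 \<in> module_hom (group_ring G) (bar_module G 2) (tensor_module G n 2) \<and>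
     F3 \<in> module_hom (group_ring G) (bar_module G 3) (tensor_module G n 3) \<and>
     F0 (bar G []) = Phi_seq G (\<lambda>_. 0) \<and>
     (\<forall>i \<in> exponents n m. F1 (bar G [gmon G g n i]) = F1_value G n g i) \<and>
     (\<forall>i \<in> exponents n m. \<forall>j \<in> exponents n m.
        F2 (bar G [gmon G g n i, gmon G g n j]) = F2_value G n m g i j) \<and>
     (\<forall>i \<in> exponents n m. \<forall>j \<in> exponents n m. \<forall>k \<in> exponents n m.
        F3 (bar G [gmon G g n i, gmon G g n j, gmon G g n k]) = F3_value G n m g i j k)"

end

theory Submission
  imports Defs
begin

text \<open>
  Write \<open>P\<^sub>p(e)\<close> (\<open>pre p e\<close>) for \<open>g\<^sub>1\<^bsup>e\<^sub>1\<^esup> \<cdots> g\<^sub>p\<^bsup>e\<^sub>p\<^esup>\<close>,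
  \<open>A\<^sub>s(e)\<close> (\<open>seg s e\<close>) for \<open>P\<^sub>s\<^sub>-\<^sub>1(e) (1 + g\<^sub>s + \<cdots> + g\<^sub>s\<^bsup>e\<^sub>s - 1\<^esup>)\<close> and
  \<open>D\<^sub>s(i, j)\<close> (\<open>carry s i j\<close>) for \<open>P\<^sub>s\<^sub>-\<^sub>1(i) P\<^sub>s\<^sub>-\<^sub>1(j) [(i\<^sub>s + j\<^sub>s) / m\<^sub>s]\<close>. All coefficients of \<open>F\<^sub>1\<close>, \<open>F\<^sub>2\<close>, \<open>F\<^sub>3\<close> are products of
  elements \<open>A\<^sub>s\<close> and \<open>D\<^sub>s\<close>. With \<open>ij\<close> (\<open>add_exp i j\<close>) for the reduced sum of exponents, the chain map equations
  follow by comparing coefficients from three identities in \<open>\<int>G\<close>: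
  \<^item> \<open>A\<^sub>s(e) T\<^sub>s = P\<^sub>s(e) - P\<^sub>s\<^sub>-\<^sub>1(e)\<close>, whose sums over intervals of \<open>s\<close> telescope;
  \<^item> \<open>D\<^sub>s(i, j) N\<^sub>s = P\<^sub>s\<^sub>-\<^sub>1(j) A\<^sub>s(i) + P\<^sub>s(i) A\<^sub>s(j) - A\<^sub>s(ij)\<close>, division with remainder by \<open>m\<^sub>s\<close>;
  \<^item> \<open>P\<^sub>s\<^sub>-\<^sub>1(i) D\<^sub>s(j, k) - D\<^sub>s(ij, k) + D\<^sub>s(i, jk) - P\<^sub>s\<^sub>-\<^sub>1(k) D\<^sub>s(i, j) = 0\<close>, the cocycle property of carries.
\<close>

section \<open>Linear algebra over the group ring\<close>

lemma zg_mult_minus_left: "zg_mult G (- x) y = - zg_mult G x y"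
  using zg_mult_add_left[of G x "- x" y] by (simp add: add_eq_0_iff)

lemma zg_mult_minus_right: "zg_mult G x (- y) = - zg_mult G x y"
  using zg_mult_add_right[of G x y "- y"] by (simp add: add_eq_0_iff)

lemma zg_mult_diff_left: "zg_mult G (x - y) z = zg_mult G x z - zg_mult G y z"
  using zg_mult_add_left[of G x "- y" z] by (simp add: zg_mult_minus_left)

lemma zg_mult_diff_right: "zg_mult G x (y - z) = zg_mult G x y - zg_mult G x z"
  using zg_mult_add_right[of G x y "- z"] by (simp add: zg_mult_minus_right)

lemma zg_mult_sum_left: "zg_mult G (\<Sum>a\<in>A. f a) x = (\<Sum>a\<in>A. zg_mult G (f a) x)"
  by (induction A rule: infinite_finite_induct) (simp_all add: zg_mult_add_left)

lemma zg_mult_sum_right: "zg_mult G x (\<Sum>a\<in>A. f a) = (\<Sum>a\<in>A. zg_mult G x (f a))"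
  by (induction A rule: infinite_finite_induct) (simp_all add: zg_mult_add_right)

lemmas zg_mult_distribs =
  zg_mult_add_left zg_mult_add_right zg_mult_diff_left zg_mult_diff_right
  zg_mult_minus_left zg_mult_minus_right

lemma single_sum: "Poly_Mapping.single k (\<Sum>a\<in>A. f a) = (\<Sum>a\<in>A. Poly_Mapping.single k (f a))"
  by (induction A rule: infinite_finite_induct) (simp_all add: single_add)

lemma carrier_group_ring: "x \<in> carrier (group_ring G) \<longleftrightarrow> Poly_Mapping.keys x \<subseteq> carrier G"
  by (simp add: group_ring_def)

lemma group_ring_simps [simp]:
  "\<one>\<^bsub>group_ring G\<^esub> = frag_of \<one>\<^bsub>G\<^esub>"
  "mult (group_ring G) = zg_mult G"
  by (simp_all add: group_ring_def)

lemma group_ring_closed [simp, intro]: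
  "0 \<in> carrier (group_ring G)"
  "a \<in> carrier G \<Longrightarrow> Poly_Mapping.single a c \<in> carrier (group_ring G)"
  "x \<in> carrier (group_ring G) \<Longrightarrow> y \<in> carrier (group_ring G) \<Longrightarrow> x + y \<in> carrier (group_ring G)"
  "x \<in> carrier (group_ring G) \<Longrightarrow> y \<in> carrier (group_ring G) \<Longrightarrow> x - y \<in> carrier (group_ring G)"
  "x \<in> carrier (group_ring G) \<Longrightarrow> - x \<in> carrier (group_ring G)"
  using Poly_Mapping.keys_add[of x y] Poly_Mapping.keys_diff[of x y]
  by (auto simp: carrier_group_ring)

lemma group_ring_sum_closed [intro]:
  "(\<And>a. a \<in> A \<Longrightarrow> f a \<in> carrier (group_ring G)) \<Longrightarrow> (\<Sum>a\<in>A. f a) \<in> carrier (group_ring G)"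
  by (induction A rule: infinite_finite_induct) auto

section \<open>Scalar action and linear extension\<close>

lemma zg_smult_single [simp]:
  "r \<bullet>\<^bsub>G\<^esub> Poly_Mapping.single b c = Poly_Mapping.single b (zg_mult G r c)"
  by (rule poly_mapping_eqI) (simp add: lookup_single when_def)

lemma zg_smult_0 [simp]: "0 \<bullet>\<^bsub>G\<^esub> v = 0" "r \<bullet>\<^bsub>G\<^esub> 0 = 0"
  by (rule poly_mapping_eqI; simp)+

lemma zg_smult_add_left: "(r + s) \<bullet>\<^bsub>G\<^esub> v = r \<bullet>\<^bsub>G\<^esub> v + s \<bullet>\<^bsub>G\<^esub> v"
  by (rule poly_mapping_eqI) (simp add: lookup_add zg_mult_add_left)

lemma zg_smult_add_right: "r \<bullet>\<^bsub>G\<^esub> (v + w) = r \<bullet>\<^bsub>G\<^esub> v + r \<bullet>\<^bsub>G\<^esub> w"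
  by (rule poly_mapping_eqI) (simp add: lookup_add zg_mult_add_right)

lemma zg_smult_diff_right: "r \<bullet>\<^bsub>G\<^esub> (v - w) = r \<bullet>\<^bsub>G\<^esub> v - r \<bullet>\<^bsub>G\<^esub> w"
  by (rule poly_mapping_eqI) (simp add: lookup_minus zg_mult_diff_right)

lemma zg_smult_sum_right: "r \<bullet>\<^bsub>G\<^esub> (\<Sum>a\<in>A. f a) = (\<Sum>a\<in>A. r \<bullet>\<^bsub>G\<^esub> f a)"
  by (induction A rule: infinite_finite_induct) (simp_all add: zg_smult_add_right)

text \<open>Terms outside the support vanish. Extensions at different vectors can thus be summed
  over one common finite set, which gives additivity.\<close>

lemma zg_linear_superset:
  assumes "finite A" "Poly_Mapping.keys v \<subseteq> A"
  shows "zg_linear G f v = (\<Sum>b\<in>A. Poly_Mapping.lookup v b \<bullet>\<^bsub>G\<^esub> f b)"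
  unfolding zg_linear_def
  by (rule sum.mono_neutral_left) (use assms in \<open>auto simp: in_keys_iff\<close>)

lemma zg_linear_0 [simp]: "zg_linear G f 0 = 0"
  by (simp add: zg_linear_def)

lemma zg_linear_single [simp]: "zg_linear G f (Poly_Mapping.single b c) = c \<bullet>\<^bsub>G\<^esub> f b"
  by (subst zg_linear_superset[of "{b}"]) auto

lemma zg_linear_add: "zg_linear G f (v + w) = zg_linear G f v + zg_linear G f w"
proof -
  let ?A = "Poly_Mapping.keys v \<union> Poly_Mapping.keys w"
  have "zg_linear G f u = (\<Sum>b\<in>?A. Poly_Mapping.lookup u b \<bullet>\<^bsub>G\<^esub> f b)"
    if "Poly_Mapping.keys u \<subseteq> ?A" for u
    by (rule zg_linear_superset) (use that in auto)
  then show ?thesis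
    using Poly_Mapping.keys_add[of v w] by (simp add: lookup_add zg_smult_add_left sum.distrib)
qed

lemma zg_linear_diff: "zg_linear G f (v - w) = zg_linear G f v - zg_linear G f w"
  using zg_linear_add[of G f "v - w" w] by simp

lemma zg_linear_sum: "zg_linear G f (\<Sum>a\<in>A. v a) = (\<Sum>a\<in>A. zg_linear G f (v a))"
  by (induction A rule: infinite_finite_induct) (simp_all add: zg_linear_add)

lemma free_zg_module_simps [simp]:
  "\<zero>\<^bsub>free_zg_module G S\<^esub> = 0"
  "add (free_zg_module G S) = (+)"
  "smult (free_zg_module G S) = zg_smult G"
  by (simp_all add: free_zg_module_def)

lemma carrier_free_zg_module:
  "v \<in> carrier (free_zg_module G S) \<longleftrightarrow>
     Poly_Mapping.keys v \<subseteq> S \<and> (\<forall>b. Poly_Mapping.lookup v b \<in> carrier (group_ring G))"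
  by (simp add: free_zg_module_def)

lemma free_zg_module_closed [simp, intro]:
  "0 \<in> carrier (free_zg_module G S)"
  "b \<in> S \<Longrightarrow> c \<in> carrier (group_ring G) \<Longrightarrow> Poly_Mapping.single b c \<in> carrier (free_zg_module G S)"
  "v \<in> carrier (free_zg_module G S) \<Longrightarrow> w \<in> carrier (free_zg_module G S) \<Longrightarrow>
     v + w \<in> carrier (free_zg_module G S)"
  "v \<in> carrier (free_zg_module G S) \<Longrightarrow> w \<in> carrier (free_zg_module G S) \<Longrightarrow>
     v - w \<in> carrier (free_zg_module G S)"
  using Poly_Mapping.keys_add[of v w] Poly_Mapping.keys_diff[of v w]
  by (auto simp: carrier_free_zg_module lookup_add lookup_minus lookup_single when_def)

lemma free_zg_module_sum_closed [intro]:
  "(\<And>a. a \<in> A \<Longrightarrow> f a \<in> carrier (free_zg_module G S)) \<Longrightarrow>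
     (\<Sum>a\<in>A. f a) \<in> carrier (free_zg_module G S)"
  by (induction A rule: infinite_finite_induct) auto

lemma zg_smult_closed [intro]:
  assumes "monoid G" "r \<in> carrier (group_ring G)" "v \<in> carrier (free_zg_module G S)"
  shows "r \<bullet>\<^bsub>G\<^esub> v \<in> carrier (free_zg_module G S)"
proof -
  have "Poly_Mapping.keys (r \<bullet>\<^bsub>G\<^esub> v) \<subseteq> Poly_Mapping.keys v" by (auto simp: in_keys_iff)
  then show ?thesis using assms by (auto simp: carrier_free_zg_module zg_mult_closed)
qed

lemma zg_smult_assoc:
  assumes "monoid G" "r \<in> carrier (group_ring G)" "s \<in> carrier (group_ring G)"
    "v \<in> carrier (free_zg_module G S)"
  shows "zg_mult G r s \<bullet>\<^bsub>G\<^esub> v = r \<bullet>\<^bsub>G\<^esub> s \<bullet>\<^bsub>G\<^esub> v"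
  by (rule poly_mapping_eqI) (use assms in \<open>simp add: carrier_free_zg_module zg_mult_assoc\<close>)

lemma zg_smult_one:
  assumes "monoid G" "v \<in> carrier (free_zg_module G S)"
  shows "frag_of \<one>\<^bsub>G\<^esub> \<bullet>\<^bsub>G\<^esub> v = v"
  by (rule poly_mapping_eqI) (use assms in \<open>simp add: carrier_free_zg_module zg_mult_one_left\<close>)

lemma zg_linear_module_hom:
  assumes "monoid G" and f: "\<And>b. b \<in> S \<Longrightarrow> f b \<in> carrier (free_zg_module G S')"
  shows "zg_linear G f \<in> module_hom (group_ring G) (free_zg_module G S) (free_zg_module G S')"
proof -
  have "zg_linear G f v \<in> carrier (free_zg_module G S')" if "v \<in> carrier (free_zg_module G S)" for v
    unfolding zg_linear_def using that assms
    by (intro free_zg_module_sum_closed zg_smult_closed) (auto simp: carrier_free_zg_module[of v])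
  moreover have "zg_linear G f (r \<bullet>\<^bsub>G\<^esub> v) = r \<bullet>\<^bsub>G\<^esub> zg_linear G f v"
    if r: "r \<in> carrier (group_ring G)" and v: "v \<in> carrier (free_zg_module G S)" for r v
  proof -
    \<comment> \<open>Scaling may shrink the support, since \<open>r\<close> can annihilate a
      coefficient; the sum is therefore kept over the support of \<open>v\<close>.\<close>
    have "zg_linear G f (r \<bullet>\<^bsub>G\<^esub> v) =
        (\<Sum>b\<in>Poly_Mapping.keys v. zg_mult G r (Poly_Mapping.lookup v b) \<bullet>\<^bsub>G\<^esub> f b)"
      by (subst zg_linear_superset[of "Poly_Mapping.keys v"]) (auto simp: in_keys_iff)
    also have "\<dots> = (\<Sum>b\<in>Poly_Mapping.keys v. r \<bullet>\<^bsub>G\<^esub> Poly_Mapping.lookup v b \<bullet>\<^bsub>G\<^esub> f b)"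
      using assms r v
      by (intro sum.cong refl zg_smult_assoc[where S = S']) (auto simp: carrier_free_zg_module[of v])
    also have "\<dots> = r \<bullet>\<^bsub>G\<^esub> zg_linear G f v"
      by (simp add: zg_linear_def zg_smult_sum_right)
    finally show ?thesis .
  qed
  ultimately show ?thesis
    by (auto simp: module_hom_def zg_linear_add)
qed

section \<open>Homomorphisms between free modules\<close>

lemma module_hom_compose:
  "f \<in> module_hom R M N \<Longrightarrow> h \<in> module_hom R N L \<Longrightarrow> (\<lambda>v. h (f v)) \<in> module_hom R M L"
  unfolding module_hom_def by (auto simp: Pi_iff)

lemma module_hom_add:
  "F \<in> module_hom R (free_zg_module G S) (free_zg_module G S') \<Longrightarrow>
     v \<in> carrier (free_zg_module G S) \<Longrightarrow> w \<in> carrier (free_zg_module G S) \<Longrightarrow> F (v + w) = F v + F w"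
  by (auto simp: module_hom_def)

lemma module_hom_smult:
  "F \<in> module_hom (group_ring G) (free_zg_module G S) (free_zg_module G S') \<Longrightarrow>
     r \<in> carrier (group_ring G) \<Longrightarrow> v \<in> carrier (free_zg_module G S) \<Longrightarrow> F (r \<bullet>\<^bsub>G\<^esub> v) = r \<bullet>\<^bsub>G\<^esub> F v"
  by (auto simp: module_hom_def)

lemma module_hom_0:
  "F \<in> module_hom R (free_zg_module G S) (free_zg_module G S') \<Longrightarrow> F 0 = 0"
  using module_hom_add[of F R G S S' 0 0] by auto

lemma module_hom_diff:
  "F \<in> module_hom R (free_zg_module G S) (free_zg_module G S') \<Longrightarrow>
     v \<in> carrier (free_zg_module G S) \<Longrightarrow> w \<in> carrier (free_zg_module G S) \<Longrightarrow> F (v - w) = F v - F w"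
  using module_hom_add[of F R G S S' "v - w" w] by auto

lemma module_hom_sum:
  assumes "F \<in> module_hom R (free_zg_module G S) (free_zg_module G S')"
    and "\<And>a. a \<in> A \<Longrightarrow> v a \<in> carrier (free_zg_module G S)"
  shows "F (\<Sum>a\<in>A. v a) = (\<Sum>a\<in>A. F (v a))"
  using assms(2)
proof (induction A rule: infinite_finite_induct)
  case (insert a A)
  then have "(\<Sum>a\<in>A. v a) \<in> carrier (free_zg_module G S)" by auto
  with insert show ?case by (simp add: module_hom_add[OF assms(1)])
qed (simp_all add: module_hom_0[OF assms(1)])

lemma module_hom_eq_zg_linear:
  assumes "comm_group G"
    and F: "F \<in> module_hom (group_ring G) (free_zg_module G S) (free_zg_module G S')"
    and v: "v \<in> carrier (free_zg_module G S)"
  shows "F v = zg_linear G (\<lambda>b. F (Poly_Mapping.single b (frag_of \<one>\<^bsub>G\<^esub>))) v"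
proof -
  interpret comm_group G by fact
  have mo: "monoid G" by unfold_locales
  let ?one = "frag_of \<one>\<^bsub>G\<^esub>"
  have L: "Poly_Mapping.lookup v b \<in> carrier (group_ring G)" for b
    using v by (simp add: carrier_free_zg_module)
  have one: "Poly_Mapping.single b ?one \<in> carrier (free_zg_module G S)" if "b \<in> Poly_Mapping.keys v" for b
    using that v by (auto simp: carrier_free_zg_module[of v])
  \<comment> \<open>The right unit law follows from the left one by commutativity; it turns
    coefficient times generator back into the coefficient.\<close>
  have "zg_mult G (Poly_Mapping.lookup v b) ?one = Poly_Mapping.lookup v b" for b
    using zg_mult_one_left[OF mo L] zg_mult_comm[OF _ L, of ?one b] by (simp add: comm_monoid_axioms)
  then have "v = (\<Sum>b\<in>Poly_Mapping.keys v. Poly_Mapping.lookup v b \<bullet>\<^bsub>G\<^esub> Poly_Mapping.single b ?one)"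
    by (intro poly_mapping_eqI) (auto simp: lookup_sum lookup_single when_def in_keys_iff)
  then have "F v = F (\<Sum>b\<in>Poly_Mapping.keys v. Poly_Mapping.lookup v b \<bullet>\<^bsub>G\<^esub> Poly_Mapping.single b ?one)"
    by simp
  also have "\<dots> = (\<Sum>b\<in>Poly_Mapping.keys v. F (Poly_Mapping.lookup v b \<bullet>\<^bsub>G\<^esub> Poly_Mapping.single b ?one))"
    by (rule module_hom_sum[OF F]) (use one L mo in blast)
  also have "\<dots> = zg_linear G (\<lambda>b. F (Poly_Mapping.single b ?one)) v"
    unfolding zg_linear_def
    by (intro sum.cong refl module_hom_smult[OF F] L one)
  finally show ?thesis .
qed

text \<open>Uniqueness in the universal property of a free module; it reduces each chain map
  equation to free generators.\<close>

lemma module_hom_free_eqI: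
  assumes "comm_group G"
    and "F \<in> module_hom (group_ring G) (free_zg_module G S) (free_zg_module G S')"
    and "F' \<in> module_hom (group_ring G) (free_zg_module G S) (free_zg_module G S')"
    and "\<And>b. b \<in> S \<Longrightarrow>
      F (Poly_Mapping.single b (frag_of \<one>\<^bsub>G\<^esub>)) = F' (Poly_Mapping.single b (frag_of \<one>\<^bsub>G\<^esub>))"
    and v: "v \<in> carrier (free_zg_module G S)"
  shows "F v = F' v"
proof -
  have "zg_linear G (\<lambda>b. F (Poly_Mapping.single b (frag_of \<one>\<^bsub>G\<^esub>))) v =
        zg_linear G (\<lambda>b. F' (Poly_Mapping.single b (frag_of \<one>\<^bsub>G\<^esub>))) v"
    unfolding zg_linear_def
    by (intro sum.cong refl arg_cong[where f = "zg_smult G _"] assms(4))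
       (use v in \<open>auto simp: carrier_free_zg_module\<close>)
  then show ?thesis
    by (simp only: module_hom_eq_zg_linear[OF assms(1,2) v] module_hom_eq_zg_linear[OF assms(1,3) v])
qed


section \<open>Identities in the group ring\<close>

text \<open>Splitting \<open>a\<close> into a multiple of \<open>c\<close> and a remainder, the
  multiple leaves the quotient additively. For \<open>c = 0\<close> both sides are 0 by the
  convention for division by zero.\<close>

lemma div_add_mod_add_div:
  fixes a b c :: nat
  shows "a div c + (a mod c + b) div c = (a + b) div c"
proof (cases "c = 0")
  case False
  have "(a + b) div c = (a mod c + b + a div c * c) div c"
    by (rule arg_cong[where f = "\<lambda>x. x div c"]) (use div_mult_mod_eq[of a c] in linarith)
  also have "\<dots> = a div c + (a mod c + b) div c"
    using False by (rule div_mult_self1)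
  finally show ?thesis by simp
qed simp

text \<open>Both sides equal \<open>(a + b + c) div m\<close>: a triple sum has the same total carry
  in either bracketing.\<close>

lemma carry_cocycle:
  fixes a b c m :: nat
  shows "(b + c) div m + (a + (b + c) mod m) div m = ((a + b) mod m + c) div m + (a + b) div m"
  using div_add_mod_add_div[of "b + c" m a] div_add_mod_add_div[of "a + b" m c]
  by (simp add: ac_simps)

lemma (in comm_group) gmon_0 [simp]: "gmon G g 0 e = \<one>"
  by (simp add: gmon_def)

lemma (in comm_group) gmon_Suc:
  assumes "\<And>l. g l \<in> carrier G"
  shows "gmon G g (Suc p) e = gmon G g p e \<otimes> g (Suc p) [^] e (Suc p)"
  unfolding gmon_def using assms
  by (subst atLeastAtMostSuc_conv) (simp_all add: m_comm)

text \<open>An abstract form of the direct product: every element is a monomial in the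
  \<open>g l\<close> with unique reduced exponents. Uniqueness is claimed only on
  \<open>{1..n}\<close>, because members of \<open>exponents n m\<close> are unconstrained
  elsewhere.\<close>

locale cyclic_decomposition = comm_group G for G (structure) +
  fixes n :: nat and m :: "nat \<Rightarrow> nat" and g :: "nat \<Rightarrow> 'a"
  assumes g_closed [simp]: "g l \<in> carrier G"
    and m_pos: "l \<in> {1..n} \<Longrightarrow> 0 < m l"
    and g_pow_m: "l \<in> {1..n} \<Longrightarrow> g l [^] m l = \<one>"
    and gmon_surj: "h \<in> carrier G \<Longrightarrow> \<exists>e\<in>exponents n m. gmon G g n e = h"
    and gmon_inj: "e \<in> exponents n m \<Longrightarrow> e' \<in> exponents n m \<Longrightarrow>
      gmon G g n e = gmon G g n e' \<Longrightarrow> l \<in> {1..n} \<Longrightarrow> e l = e' l"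
begin

abbreviation zg_times (infixl \<open>\<star>\<close> 70) where "x \<star> y \<equiv> zg_mult G x y"
abbreviation ZG where "ZG \<equiv> carrier (group_ring G)"
abbreviation T where "T \<equiv> T_elt G g"
abbreviation N where "N \<equiv> N_elt G m g"

lemma monoid_G: "monoid G"
  by unfold_locales

lemma times_closed [simp]: "x \<in> ZG \<Longrightarrow> y \<in> ZG \<Longrightarrow> x \<star> y \<in> ZG"
  by (rule zg_mult_closed[OF monoid_G])

lemma times_assoc: "x \<in> ZG \<Longrightarrow> y \<in> ZG \<Longrightarrow> z \<in> ZG \<Longrightarrow> x \<star> y \<star> z = x \<star> (y \<star> z)"
  by (rule zg_mult_assoc[OF monoid_G])

lemma times_commute: "x \<in> ZG \<Longrightarrow> y \<in> ZG \<Longrightarrow> x \<star> y = y \<star> x"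
  by (rule zg_mult_comm) (unfold_locales)

lemma times_left_commute:
  "x \<in> ZG \<Longrightarrow> y \<in> ZG \<Longrightarrow> z \<in> ZG \<Longrightarrow> x \<star> (y \<star> z) = y \<star> (x \<star> z)"
  by (metis times_assoc times_commute)

lemmas times_ac = times_assoc times_commute times_left_commute

lemma one_times [simp]: "x \<in> ZG \<Longrightarrow> frag_of \<one> \<star> x = x"
  by (rule zg_mult_one_left[OF monoid_G])

lemma times_one [simp]: "x \<in> ZG \<Longrightarrow> x \<star> frag_of \<one> = x"
  by (simp add: times_commute[of x])

lemma T_closed [simp]: "T s \<in> ZG"
  by (simp add: T_elt_def)

lemma N_closed [simp]: "N s \<in> ZG"
  unfolding N_elt_def by (rule group_ring_sum_closed) simp

lemma gmon_closed [simp]: "gmon G g p e \<in> carrier G"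
  unfolding gmon_def by (rule finprod_closed) simp

lemma gmon_cong: "(\<And>l. l \<in> {1..p} \<Longrightarrow> e l = e' l) \<Longrightarrow> gmon G g p e = gmon G g p e'"
  unfolding gmon_def by (rule finprod_cong) (auto simp: simp_implies_def)

lemma gmon_zero [simp]: "gmon G g p (\<lambda>_. 0) = \<one>"
  by (simp add: gmon_def)

lemma gmon_add: "gmon G g p (\<lambda>l. e l + e' l) = gmon G g p e \<otimes> gmon G g p e'"
  unfolding gmon_def by (subst finprod_multf[symmetric]) (auto simp: nat_pow_mult)

lemma g_pow_mod:
  assumes "l \<in> {1..n}" shows "g l [^] (a mod m l) = g l [^] a"
proof -
  have "g l [^] a = g l [^] (m l * (a div m l) + a mod m l)" by simp
  also have "\<dots> = (g l [^] m l) [^] (a div m l) \<otimes> g l [^] (a mod m l)"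
    by (simp only: nat_pow_mult[symmetric] nat_pow_pow[symmetric] g_closed)
  finally show ?thesis using assms by (simp add: g_pow_m)
qed

lemma gmon_mod: "p \<le> n \<Longrightarrow> gmon G g p (\<lambda>l. e l mod m l) = gmon G g p e"
  unfolding gmon_def by (rule finprod_cong) (auto simp: simp_implies_def g_pow_mod)

section \<open>Prefixes, segments, carries and their identities\<close>

definition add_exp :: "(nat \<Rightarrow> nat) \<Rightarrow> (nat \<Rightarrow> nat) \<Rightarrow> nat \<Rightarrow> nat" where
  "add_exp e e' = (\<lambda>l. (e l + e' l) mod m l)"

lemma gmon_add_exp: "p \<le> n \<Longrightarrow> gmon G g p (add_exp e e') = gmon G g p e \<otimes> gmon G g p e'"
  by (simp add: add_exp_def gmon_mod[of p "\<lambda>l. e l + e' l"] gmon_add)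

lemma add_exp_exponents [simp]: "add_exp e e' \<in> exponents n m"
  using m_pos by (auto simp: add_exp_def exponents_def)

definition pre :: "nat \<Rightarrow> (nat \<Rightarrow> nat) \<Rightarrow> 'a \<Rightarrow>\<^sub>0 int" where
  "pre p e = frag_of (gmon G g p e)"

text \<open>A truncated norm element: for \<open>k = m s\<close> it is \<open>N s\<close>.\<close>

definition geom :: "nat \<Rightarrow> nat \<Rightarrow> 'a \<Rightarrow>\<^sub>0 int" where
  "geom s k = (\<Sum>\<alpha><k. frag_of (g s [^] \<alpha>))"

definition seg :: "nat \<Rightarrow> (nat \<Rightarrow> nat) \<Rightarrow> 'a \<Rightarrow>\<^sub>0 int" where
  "seg s e = (\<Sum>\<alpha><e s. frag_of (gmon G g (s - 1) e \<otimes> g s [^] \<alpha>))"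

text \<open>The exponent sum is left unreduced, so that this is literally the coefficient of
  \<open>Phi G [s, s]\<close> in \<open>F2_value\<close>; \<open>carry_eq\<close> supplies the
  product form.\<close>

definition carry :: "nat \<Rightarrow> (nat \<Rightarrow> nat) \<Rightarrow> (nat \<Rightarrow> nat) \<Rightarrow> 'a \<Rightarrow>\<^sub>0 int" where
  "carry s i j = Poly_Mapping.single (gmon G g (s - 1) (\<lambda>l. i l + j l)) (int ((i s + j s) div m s))"

lemma pre_closed [simp]: "pre p e \<in> ZG"
  by (simp add: pre_def)

lemma geom_closed [simp]: "geom s k \<in> ZG"
  unfolding geom_def by (rule group_ring_sum_closed) simp

lemma seg_closed [simp]: "seg s e \<in> ZG"
  unfolding seg_def by (rule group_ring_sum_closed) simp

lemma carry_closed [simp]: "carry s i j \<in> ZG"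
  by (simp add: carry_def)

lemma pre_0 [simp]: "pre 0 e = frag_of \<one>"
  by (simp add: pre_def)

lemma pre_Suc: "pre (Suc p) e = pre p e \<star> frag_of (g (Suc p) [^] e (Suc p))"
  by (simp add: pre_def gmon_Suc zg_mult_single)

lemma pre_add_exp: "p \<le> n \<Longrightarrow> pre p (add_exp e e') = pre p e \<star> pre p e'"
  by (simp add: pre_def gmon_add_exp zg_mult_single)

lemma geom_add: "geom s (a + b) = geom s a + frag_of (g s [^] a) \<star> geom s b"
  by (induction b) (simp_all add: geom_def zg_mult_add_right zg_mult_single nat_pow_mult add.assoc)

text \<open>Since \<open>g s [^] m s\<close> is 1, a geometric sum of length \<open>a\<close>
  consists of \<open>a div m s\<close> full periods, each equal to \<open>N s\<close>, and a
  remainder.\<close>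

lemma geom_div_mod:
  assumes "s \<in> {1..n}"
  shows "geom s a = Poly_Mapping.single \<one> (int (a div m s)) \<star> N s + geom s (a mod m s)"
proof -
  have *: "geom s (m s * q) = Poly_Mapping.single \<one> (int q) \<star> N s" for q
  proof (induction q)
    case (Suc q)
    have "geom s (m s * Suc q) = geom s (m s) + frag_of (g s [^] m s) \<star> geom s (m s * q)"
      by (simp flip: geom_add)
    also have "geom s (m s) = N s"
      by (simp add: geom_def N_elt_def)
    finally show ?case
      using assms by (simp add: Suc g_pow_m single_add zg_mult_add_left)
  qed (simp add: geom_def)
  have "geom s (m s * (a div m s) + a mod m s) = geom s (m s * (a div m s)) +
      frag_of (g s [^] (m s * (a div m s))) \<star> geom s (a mod m s)"
    by (rule geom_add)
  also have "g s [^] (m s * (a div m s)) = \<one>"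
    using assms by (simp add: g_pow_m flip: nat_pow_pow)
  finally show ?thesis by (simp add: *)
qed

lemma seg_eq: "seg s e = pre (s - 1) e \<star> geom s (e s)"
  by (simp add: seg_def pre_def geom_def zg_mult_sum_right zg_mult_single)

lemma carry_eq:
  "carry s i j = pre (s - 1) i \<star> pre (s - 1) j \<star> Poly_Mapping.single \<one> (int ((i s + j s) div m s))"
  by (simp add: carry_def pre_def gmon_add zg_mult_single)

lemma geom_T: "geom s k \<star> T s = frag_of (g s [^] k) - frag_of \<one>"
proof -
  have "geom s k \<star> T s = (\<Sum>\<alpha><k. frag_of (g s [^] Suc \<alpha>) - frag_of (g s [^] \<alpha>))"
    unfolding geom_def T_elt_def zg_mult_sum_left
    by (intro sum.cong refl) (simp add: zg_mult_diff_right zg_mult_single)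
  also have "\<dots> = frag_of (g s [^] k) - frag_of \<one>"
    by (subst sum_lessThan_telescope) simp
  finally show ?thesis .
qed

text \<open>The geometric series telescopes, and its top power extends the prefix by one factor. At
  \<open>s = 0\<close> the truncated \<open>s - 1\<close> would not shorten the prefix.\<close>

lemma seg_T:
  assumes "1 \<le> s" shows "seg s e \<star> T s = pre s e - pre (s - 1) e"
proof -
  obtain p where "s = Suc p" using assms by (cases s) auto
  then show ?thesis
    by (simp add: seg_eq times_assoc geom_T pre_Suc zg_mult_diff_right)
qed

text \<open>The interval is open on the left so that consecutive differences join; with
  \<open>s = 0\<close> the lower end is the empty prefix 1.\<close>

lemma seg_T_telescope:
  assumes "s \<le> u" shows "(\<Sum>t\<in>{s<..u}. seg t e \<star> T t) = pre u e - pre s e"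
  using assms
proof (induction u rule: dec_induct)
  case (step u)
  have "{s<..Suc u} = insert (Suc u) {s<..u}" using step by auto
  then show ?case using step by (simp add: seg_T)
qed simp

lemma carry_N:
  assumes "s \<in> {1..n}"
  shows "carry s i j \<star> N s = pre (s - 1) j \<star> seg s i + pre s i \<star> seg s j - seg s (add_exp i j)"
proof -
  obtain p where s: "s = Suc p" and p: "p \<le> n" using assms by (cases s) auto
  let ?c = "Poly_Mapping.single \<one> (int ((i s + j s) div m s))"
  \<comment> \<open>The geometric sum of length \<open>i s + j s\<close> is computed twice: split at
    \<open>i s\<close>, and as full periods plus a remainder of length
    \<open>add_exp i j s\<close>.\<close>
  have "?c \<star> N s = geom s (i s) + frag_of (g s [^] i s) \<star> geom s (j s) - geom s (add_exp i j s)"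
    using geom_div_mod[OF assms, of "i s + j s"] by (simp add: geom_add add_exp_def)
  then have "carry s i j \<star> N s = pre p i \<star> pre p j \<star>
      (geom s (i s) + frag_of (g s [^] i s) \<star> geom s (j s) - geom s (add_exp i j s))"
    by (simp add: carry_eq times_assoc s)
  \<comment> \<open>Prefixes are multiplicative even for reduced exponent sums, so
    \<open>pre p i \<star> pre p j\<close> is the prefix of \<open>add_exp i j\<close>.\<close>
  also have "\<dots> = pre p j \<star> seg s i + pre s i \<star> seg s j - seg s (add_exp i j)"
    by (simp add: s seg_eq pre_Suc pre_add_exp[OF p] zg_mult_distribs times_ac)
  finally show ?thesis by (simp add: s)
qed

lemma carry_coboundary:
  assumes "s \<in> {1..n}"
  shows "pre (s - 1) i \<star> carry s j k - carry s (add_exp i j) k + carry s i (add_exp j k)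
    - pre (s - 1) k \<star> carry s i j = 0"
proof -
  let ?c = "\<lambda>i j. Poly_Mapping.single \<one> (int ((i s + j s) div m s))"
  let ?P = "\<lambda>e. pre (s - 1) e"
  have p: "s - 1 \<le> n" using assms by auto
  \<comment> \<open>Differences are formed over the integers, since subtraction of naturals
    truncates.\<close>
  have "int ((j s + k s) div m s) - int ((add_exp i j s + k s) div m s)
      + int ((i s + add_exp j k s) div m s) - int ((i s + j s) div m s) = 0"
    using arg_cong[where f = int, OF carry_cocycle[of "j s" "k s" "m s" "i s"]]
    unfolding add_exp_def of_nat_add by linarith
  then have "?c j k - ?c (add_exp i j) k + ?c i (add_exp j k) - ?c i j = 0"
    by (simp only: single_add[symmetric] single_diff[symmetric] single_zero)
  \<comment> \<open>All four terms of the claim share the factor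
    \<open>?P i \<star> ?P j \<star> ?P k\<close>, because \<open>?P\<close> is multiplicative on
    \<open>add_exp\<close>.\<close>
  then have "0 = ?P i \<star> ?P j \<star> ?P k \<star> (?c j k - ?c (add_exp i j) k + ?c i (add_exp j k) - ?c i j)"
    by simp
  also have "\<dots> = ?P i \<star> carry s j k - carry s (add_exp i j) k + carry s i (add_exp j k)
      - ?P k \<star> carry s i j"
    unfolding carry_eq pre_add_exp[OF p] by (simp add: zg_mult_distribs times_ac)
  finally show ?thesis by simp
qed

end


section \<open>The tensor differential\<close>

lemma count_list_Nil_eq: "count_list [] = (\<lambda>_. 0)"
  by auto

text \<open>For the generator with lower indices \<open>L\<close>, the sign exponent of the
  differential is the number of entries below \<open>i\<close>. An entry 0 could be counted only on
  the right, hence the bound on \<open>set L\<close>.\<close>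

lemma sum_count_list_atLeastLessThan:
  fixes L :: "nat list"
  shows "set L \<subseteq> {1..} \<Longrightarrow> (\<Sum>l\<in>{1..<i}. count_list L l) = length (filter (\<lambda>l. l < i) L)"
proof (induction L)
  case (Cons a L)
  have "(\<Sum>l\<in>{1..<i}. count_list (a # L) l) = (\<Sum>l\<in>{1..<i}. count_list L l) + (\<Sum>l\<in>{1..<i}. if a = l then 1 else 0)"
    unfolding sum.distrib[symmetric] by (rule sum.cong) auto
  also have "(\<Sum>l\<in>{1..<i}. if a = l then 1 else 0 :: nat) = (if a < i then 1 else 0)"
    using Cons.prems by (subst sum.delta') auto
  finally show ?case using Cons by simp
qed simp

text \<open>A sum of linear extensions is the extension of the summed values, so the results on
  \<open>zg_linear\<close> apply to the whole differential.\<close>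

lemma tensor_d_eq_zg_linear:
  "tensor_d G n m g = zg_linear G (\<lambda>a. \<Sum>i=1..n. tensor_d_part G m g i a)"
  by (rule ext) (simp add: tensor_d_def zg_linear_def zg_smult_sum_right, rule sum.swap)

context cyclic_decomposition
begin

text \<open>This is \<open>c\<close> times \<open>Phi G L\<close>, kept as a
  \<open>Poly_Mapping.single\<close> so that coefficients are compared inside its second
  argument.\<close>

abbreviation \<phi> :: "nat list \<Rightarrow> ('a \<Rightarrow>\<^sub>0 int) \<Rightarrow> (nat \<Rightarrow> nat) \<Rightarrow>\<^sub>0 ('a \<Rightarrow>\<^sub>0 int)" where
  "\<phi> L c \<equiv> Poly_Mapping.single (count_list L) c"

lemma smult_Phi: "c \<in> ZG \<Longrightarrow> c \<bullet>\<^bsub>G\<^esub> Phi G L = \<phi> L c"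
  by (simp add: Phi_def Phi_seq_def)

lemma F1_value_eq: "F1_value G n g i = (\<Sum>s=1..n. \<phi> [s] (seg s i))"
  unfolding F1_value_def seg_def single_sum by (simp add: smult_Phi)

lemma F2_value_eq:
  "F2_value G n m g i j = (\<Sum>s=1..n. \<phi> [s, s] (carry s i j))
     - (\<Sum>s=1..n. \<Sum>t\<in>{s<..n}. \<phi> [s, t] (seg s j \<star> seg t i))"
proof -
  \<comment> \<open>By commutativity the summand is a factor in \<alpha> times a factor in \<beta>,
    so the double sum is a product of two segments.\<close>
  have "frag_of (gmon G g (t - 1) i \<otimes> gmon G g (s - 1) j \<otimes> g s [^] \<alpha> \<otimes> g t [^] \<beta>) =
    frag_of (gmon G g (s - 1) j \<otimes> g s [^] \<alpha>) \<star> frag_of (gmon G g (t - 1) i \<otimes> g t [^] \<beta>)"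
    for s t and \<alpha> \<beta> :: nat
    by (simp add: zg_mult_single m_ac)
  then have "(\<Sum>\<alpha><j s. \<Sum>\<beta><i t.
      frag_of (gmon G g (t - 1) i \<otimes> gmon G g (s - 1) j \<otimes> g s [^] \<alpha> \<otimes> g t [^] \<beta>) \<bullet>\<^bsub>G\<^esub> Phi G [s, t])
    = \<phi> [s, t] (seg s j \<star> seg t i)" for s t
    unfolding seg_def zg_mult_sum_left unfolding zg_mult_sum_right single_sum by (simp add: smult_Phi)
  then show ?thesis
    unfolding F2_value_def by (simp add: smult_Phi carry_def)
qed

lemma F3_value_eq:
  "F3_value G n m g i j k =
     (\<Sum>r=1..n. \<phi> [r, r, r] (carry r j k \<star> seg r i))
     + (\<Sum>r=1..n. \<Sum>t\<in>{r<..n}. \<phi> [r, r, t] (carry r j k \<star> seg t i))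
     + (\<Sum>r=1..n. \<Sum>t\<in>{r<..n}. \<phi> [r, t, t] (carry t i j \<star> seg r k))
     - (\<Sum>r=1..n. \<Sum>s\<in>{r<..n}. \<Sum>t\<in>{s<..n}. \<phi> [r, s, t] (seg t i \<star> (seg s j \<star> seg r k)))"
  unfolding F3_value_def carry_def[symmetric] seg_def[symmetric]
  by (simp add: smult_Phi)

lemma tensor_d_simps:
  "tensor_d G n m g (v + w) = tensor_d G n m g v + tensor_d G n m g w"
  "tensor_d G n m g (v - w) = tensor_d G n m g v - tensor_d G n m g w"
  "tensor_d G n m g (\<Sum>a\<in>A. f a) = (\<Sum>a\<in>A. tensor_d G n m g (f a))"
  by (simp_all add: tensor_d_eq_zg_linear zg_linear_add zg_linear_diff zg_linear_sum)

text \<open>Positions not occurring in \<open>L\<close> have exponent 0 and contribute nothing, so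
  the sum over \<open>{1..n}\<close> shrinks to \<open>set L\<close>.\<close>

lemma tensor_d_phi:
  assumes "set L \<subseteq> {1..n}" "c \<in> ZG"
  shows "tensor_d G n m g (\<phi> L c) = (\<Sum>i\<in>set L.
    Poly_Mapping.single ((count_list L)(i := count_list L i - 1))
      (c \<star> (Poly_Mapping.single \<one> ((-1) ^ length (filter (\<lambda>l. l < i) L)) \<star>
         (if even (count_list L i) then N i else T i))))"
proof -
  have "tensor_d G n m g (\<phi> L c) = (\<Sum>i=1..n. c \<bullet>\<^bsub>G\<^esub> tensor_d_part G m g i (count_list L))"
    by (simp add: tensor_d_def)
  also have "\<dots> = (\<Sum>i\<in>set L. c \<bullet>\<^bsub>G\<^esub> tensor_d_part G m g i (count_list L))"
    using assms by (intro sum.mono_neutral_right) (auto simp: tensor_d_part_def)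
  also have "set L \<subseteq> {1..}" using assms by auto
  note sum_count_list_atLeastLessThan[OF this]
  ultimately show ?thesis
    by (auto intro!: sum.cong simp: tensor_d_part_def Phi_seq_def count_list_0_iff)
qed

section \<open>Boundaries of the generators in degrees 1, 2 and 3\<close>

lemma tensor_d_phi_1:
  assumes "s \<in> {1..n}" "c \<in> ZG"
  shows "tensor_d G n m g (\<phi> [s] c) = \<phi> [] (c \<star> T s)"
proof -
  have "(count_list [s])(s := 0) = count_list []" by auto
  then show ?thesis using assms by (subst tensor_d_phi) simp_all
qed

lemma tensor_d_phi_2_eq:
  assumes "s \<in> {1..n}" "c \<in> ZG"
  shows "tensor_d G n m g (\<phi> [s, s] c) = \<phi> [s] (c \<star> N s)"
proof -
  have "(count_list [s, s])(s := Suc 0) = count_list [s]" by auto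
  then show ?thesis using assms by (subst tensor_d_phi) simp_all
qed

lemma tensor_d_phi_2_less:
  assumes "s \<in> {1..n}" "t \<in> {1..n}" "s < t" "c \<in> ZG"
  shows "tensor_d G n m g (\<phi> [s, t] c) = \<phi> [t] (c \<star> T s) - \<phi> [s] (c \<star> T t)"
proof -
  have "(count_list [s, t])(s := 0) = count_list [t]" "(count_list [s, t])(t := 0) = count_list [s]"
    using assms by auto
  then show ?thesis
    using assms by (subst tensor_d_phi) (simp_all add: zg_mult_minus_left zg_mult_minus_right single_uminus)
qed

lemma tensor_d_phi_3_eq:
  assumes "r \<in> {1..n}" "c \<in> ZG"
  shows "tensor_d G n m g (\<phi> [r, r, r] c) = \<phi> [r, r] (c \<star> T r)"
proof -
  have "(count_list [r, r, r])(r := Suc (Suc 0)) = count_list [r, r]" by auto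
  then show ?thesis using assms by (subst tensor_d_phi) simp_all
qed

text \<open>Two entries precede \<open>t\<close>, so its sign is positive; \<open>r\<close> occurs
  twice and gives a norm.\<close>

lemma tensor_d_phi_3_eq_less:
  assumes "r \<in> {1..n}" "t \<in> {1..n}" "r < t" "c \<in> ZG"
  shows "tensor_d G n m g (\<phi> [r, r, t] c) = \<phi> [r, t] (c \<star> N r) + \<phi> [r, r] (c \<star> T t)"
proof -
  have "(count_list [r, r, t])(r := Suc 0) = count_list [r, t]"
    "(count_list [r, r, t])(t := 0) = count_list [r, r]"
    using assms by auto
  then show ?thesis using assms by (subst tensor_d_phi) simp_all
qed

text \<open>One entry precedes the repeated \<open>t\<close>, so the norm term is negative.\<close>

lemma tensor_d_phi_3_less_eq:
  assumes "r \<in> {1..n}" "t \<in> {1..n}" "r < t" "c \<in> ZG"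
  shows "tensor_d G n m g (\<phi> [r, t, t] c) = \<phi> [t, t] (c \<star> T r) - \<phi> [r, t] (c \<star> N t)"
proof -
  have "(count_list [r, t, t])(r := 0) = count_list [t, t]"
    "(count_list [r, t, t])(t := Suc 0) = count_list [r, t]"
    using assms by auto
  then show ?thesis
    using assms by (subst tensor_d_phi) (simp_all add: zg_mult_minus_left zg_mult_minus_right single_uminus)
qed

text \<open>The signs alternate because 0, 1 and 2 entries precede \<open>r\<close>,
  \<open>s\<close> and \<open>t\<close>.\<close>

lemma tensor_d_phi_3_less:
  assumes "r \<in> {1..n}" "s \<in> {1..n}" "t \<in> {1..n}" "r < s" "s < t" "c \<in> ZG"
  shows "tensor_d G n m g (\<phi> [r, s, t] c) =
    \<phi> [s, t] (c \<star> T r) - \<phi> [r, t] (c \<star> T s) + \<phi> [r, s] (c \<star> T t)"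
proof -
  have "(count_list [r, s, t])(r := 0) = count_list [s, t]"
    "(count_list [r, s, t])(s := 0) = count_list [r, t]"
    "(count_list [r, s, t])(t := 0) = count_list [r, s]"
    using assms by auto
  then show ?thesis
    using assms by (subst tensor_d_phi) (simp_all add: zg_mult_minus_left zg_mult_minus_right single_uminus)
qed

end


section \<open>The chain map equations on generators\<close>

lemma sum_less_pairs_swap:
  fixes f :: "nat \<Rightarrow> nat \<Rightarrow> 'b :: comm_monoid_add"
  shows "(\<Sum>s=1..n. \<Sum>t\<in>{s<..n}. f s t) = (\<Sum>t=1..n. \<Sum>s\<in>{1..<t}. f s t)"
proof -
  have "(\<Sum>s=1..n. \<Sum>t\<in>{s<..n}. f s t) = (\<Sum>s=1..n. \<Sum>t\<in>{t \<in> {1..n}. s < t}. f s t)"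
    by (intro sum.cong refl) auto
  also have "\<dots> = (\<Sum>t=1..n. \<Sum>s\<in>{s \<in> {1..n}. s < t}. f s t)"
    by (rule sum.swap_restrict) auto
  also have "\<dots> = (\<Sum>t=1..n. \<Sum>s\<in>{1..<t}. f s t)"
    by (intro sum.cong refl) auto
  finally show ?thesis .
qed

text \<open>Serves to collect the boundary terms at one generator \<open>[s, t]\<close>: the index
  \<open>r\<close> deleted by the differential moves innermost.\<close>

lemma sum_less_triples_rotate:
  fixes f :: "nat \<Rightarrow> nat \<Rightarrow> nat \<Rightarrow> 'b :: comm_monoid_add"
  shows "(\<Sum>r=1..n. \<Sum>s\<in>{r<..n}. \<Sum>t\<in>{s<..n}. f r s t) =
    (\<Sum>s=1..n. \<Sum>t\<in>{s<..n}. \<Sum>r\<in>{1..<s}. f r s t)"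
  unfolding sum_less_pairs_swap[where f = "\<lambda>r s. \<Sum>t\<in>{s<..n}. f r s t"]
  by (rule sum.cong[OF refl]) (rule sum.swap)

text \<open>Needed where the differential deletes the middle index.\<close>

lemma sum_less_triples_mid:
  fixes f :: "nat \<Rightarrow> nat \<Rightarrow> nat \<Rightarrow> 'b :: comm_monoid_add"
  shows "(\<Sum>r=1..n. \<Sum>s\<in>{r<..n}. \<Sum>t\<in>{s<..n}. f r s t) =
    (\<Sum>r=1..n. \<Sum>t\<in>{r<..n}. \<Sum>s\<in>{r<..<t}. f r s t)"
proof (rule sum.cong[OF refl])
  fix r
  have "(\<Sum>s\<in>{r<..n}. \<Sum>t\<in>{s<..n}. f r s t) = (\<Sum>s\<in>{r<..n}. \<Sum>t\<in>{t \<in> {r<..n}. s < t}. f r s t)"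
    by (intro sum.cong refl) auto
  also have "\<dots> = (\<Sum>t\<in>{r<..n}. \<Sum>s\<in>{s \<in> {r<..n}. s < t}. f r s t)"
    by (rule sum.swap_restrict) auto
  also have "\<dots> = (\<Sum>t\<in>{r<..n}. \<Sum>s\<in>{r<..<t}. f r s t)"
    by (intro sum.cong refl) auto
  finally show "(\<Sum>s\<in>{r<..n}. \<Sum>t\<in>{s<..n}. f r s t) = (\<Sum>t\<in>{r<..n}. \<Sum>s\<in>{r<..<t}. f r s t)" .
qed

context cyclic_decomposition
begin

section \<open>Boundaries of the prescribed values\<close>

lemma sum_times_seg_T:
  assumes "c \<in> ZG" "a \<le> b"
  shows "(\<Sum>t\<in>{a<..b}. c \<star> seg t e \<star> T t) = c \<star> (pre b e - pre a e)"
  using assms by (simp add: times_assoc flip: zg_mult_sum_right seg_T_telescope)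

text \<open>The coefficients \<open>seg s i \<star> T s\<close> telescope over all positions, from
  the empty prefix to the full monomial.\<close>

lemma tensor_d_F1_value: "tensor_d G n m g (F1_value G n g i) = \<phi> [] (pre n i - frag_of \<one>)"
proof -
  have "tensor_d G n m g (F1_value G n g i) = (\<Sum>s=1..n. \<phi> [] (seg s i \<star> T s))"
    unfolding F1_value_eq tensor_d_simps by (intro sum.cong refl tensor_d_phi_1) auto
  also have "\<dots> = \<phi> [] (\<Sum>s\<in>{0<..n}. seg s i \<star> T s)"
    unfolding single_sum by (intro sum.cong refl) auto
  finally show ?thesis by (simp add: seg_T_telescope)
qed

lemma tensor_d_F2_value:
  "tensor_d G n m g (F2_value G n m g i j) =
     pre n i \<bullet>\<^bsub>G\<^esub> F1_value G n g j - F1_value G n g (add_exp i j) + F1_value G n g i"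
proof -
  have "tensor_d G n m g (F2_value G n m g i j) = (\<Sum>s=1..n. \<phi> [s] (carry s i j \<star> N s))
      - (\<Sum>s=1..n. \<Sum>t\<in>{s<..n}. \<phi> [t] (seg s j \<star> seg t i \<star> T s) - \<phi> [s] (seg s j \<star> seg t i \<star> T t))"
    unfolding F2_value_eq tensor_d_simps
    by (intro arg_cong2[where f = minus] sum.cong refl tensor_d_phi_2_eq tensor_d_phi_2_less) auto
  \<comment> \<open>The coefficient at \<open>[s]\<close> collects the norm term from
    \<open>[s, s]\<close>, the pairs \<open>[r, s]\<close> with \<open>r\<close> deleted and the
    pairs \<open>[s, t]\<close> with \<open>t\<close> deleted.\<close>
  also have "\<dots> = (\<Sum>s=1..n. \<phi> [s] (carry s i j \<star> N s - (\<Sum>r\<in>{1..<s}. seg r j \<star> seg s i \<star> T r)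
        + (\<Sum>t\<in>{s<..n}. seg s j \<star> seg t i \<star> T t)))"
    unfolding sum_subtractf sum_less_pairs_swap[where f = "\<lambda>s t. \<phi> [t] (seg s j \<star> seg t i \<star> T s)"]
    by (simp add: single_add single_diff single_sum sum.distrib sum_subtractf)
  also have "\<dots> = (\<Sum>s=1..n. \<phi> [s] (pre n i \<star> seg s j - seg s (add_exp i j) + seg s i))"
  proof (intro sum.cong refl arg_cong[where f = "Poly_Mapping.single _"])
    fix s assume s: "s \<in> {1..n}"
    have "{1..<s} = {0<..s - 1}" by auto
    then have "(\<Sum>r\<in>{1..<s}. seg r j \<star> seg s i \<star> T r) = seg s i \<star> (pre (s - 1) j - pre 0 j)"
      by (simp add: times_commute[of _ "seg s i"] sum_times_seg_T del: pre_0)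
    moreover have "(\<Sum>t\<in>{s<..n}. seg s j \<star> seg t i \<star> T t) = seg s j \<star> (pre n i - pre s i)"
      using s by (simp add: sum_times_seg_T)
    \<comment> \<open>By \<open>carry_N\<close> the norm term cancels the inner ends
      \<open>pre (s - 1) j\<close> and \<open>pre s i\<close> of the two telescopes; the outer ends
      1 and \<open>pre n i\<close> survive.\<close>
    ultimately show "carry s i j \<star> N s - (\<Sum>r\<in>{1..<s}. seg r j \<star> seg s i \<star> T r)
        + (\<Sum>t\<in>{s<..n}. seg s j \<star> seg t i \<star> T t) = pre n i \<star> seg s j - seg s (add_exp i j) + seg s i"
      by (simp add: carry_N[OF s] zg_mult_distribs times_commute)
  qed
  also have "\<dots> = pre n i \<bullet>\<^bsub>G\<^esub> F1_value G n g j - F1_value G n g (add_exp i j) + F1_value G n g i"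
    by (simp add: F1_value_eq zg_smult_sum_right single_add single_diff sum.distrib sum_subtractf)
  finally show ?thesis .
qed

text \<open>The generators \<open>[s, s, s]\<close>, \<open>[s, s, t]\<close> and
  \<open>[r, s, s]\<close> contribute to \<open>[s, s]\<close>. The first two telescope together
  from \<open>pre (s - 1) i\<close> to \<open>pre n i\<close>, the third from 1 to
  \<open>pre (s - 1) k\<close>; \<open>carry_coboundary\<close> trades the two ends at
  \<open>s - 1\<close> for the carries with \<open>add_exp\<close>.\<close>

lemma tensor_d_F3_value_coeff_eq:
  assumes s: "s \<in> {1..n}"
  shows "carry s j k \<star> seg s i \<star> T s + (\<Sum>t\<in>{s<..n}. carry s j k \<star> seg t i \<star> T t)
      + (\<Sum>r\<in>{1..<s}. carry s i j \<star> seg r k \<star> T r)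
    = pre n i \<star> carry s j k - carry s (add_exp i j) k + carry s i (add_exp j k) - carry s i j"
proof -
  have "{1..<s} = {0<..s - 1}" by auto
  then have 1: "(\<Sum>r\<in>{1..<s}. carry s i j \<star> seg r k \<star> T r) = carry s i j \<star> (pre (s - 1) k - pre 0 k)"
    by (simp add: sum_times_seg_T del: pre_0)
  have 2: "(\<Sum>t\<in>{s<..n}. carry s j k \<star> seg t i \<star> T t) = carry s j k \<star> (pre n i - pre s i)"
    using s by (simp add: sum_times_seg_T)
  have 3: "carry s j k \<star> seg s i \<star> T s = carry s j k \<star> (pre s i - pre (s - 1) i)"
    using s by (simp add: times_assoc seg_T)
  have 4: "carry s i (add_exp j k) =
      carry s (add_exp i j) k + pre (s - 1) k \<star> carry s i j - pre (s - 1) i \<star> carry s j k"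
    using carry_coboundary[OF s, of i j k] by (simp add: algebra_simps)
  show ?thesis
    unfolding 1 2 3 4 by (simp add: zg_mult_distribs times_commute[of "carry _ _ _"])
qed

text \<open>At \<open>[s, t]\<close> there are norm terms from \<open>[s, s, t]\<close> and
  \<open>[s, t, t]\<close> and three telescopes, for a deleted index below \<open>s\<close>, between
  \<open>s\<close> and \<open>t\<close>, or above \<open>t\<close>. Expanding both norm terms by
  \<open>carry_N\<close> cancels every inner end; only 1 and \<open>pre n i\<close> survive.\<close>

lemma tensor_d_F3_value_coeff_less:
  assumes s: "s \<in> {1..n}" and t: "t \<in> {s<..n}"
  shows "carry s j k \<star> seg t i \<star> N s - carry t i j \<star> seg s k \<star> N t
      - (\<Sum>r\<in>{1..<s}. seg t i \<star> (seg s j \<star> seg r k) \<star> T r)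
      + (\<Sum>q\<in>{s<..<t}. seg t i \<star> (seg q j \<star> seg s k) \<star> T q)
      - (\<Sum>u\<in>{t<..n}. seg u i \<star> (seg t j \<star> seg s k) \<star> T u)
    = seg s k \<star> seg t (add_exp i j) - pre n i \<star> (seg s k \<star> seg t j)
      - seg s (add_exp j k) \<star> seg t i + seg s j \<star> seg t i"
proof -
  have t': "t \<in> {1..n}" using s t by auto
  \<comment> \<open>The deleted index is moved next to its \<open>T\<close>, and the ranges become
    half-open on the left, the form that \<open>sum_times_seg_T\<close> needs.\<close>
  have 1: "(\<Sum>r\<in>{1..<s}. seg t i \<star> (seg s j \<star> seg r k) \<star> T r) =
      (\<Sum>r\<in>{0<..s - 1}. seg t i \<star> seg s j \<star> seg r k \<star> T r)"
    by (rule sum.cong) (auto simp: times_assoc)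
  have 2: "(\<Sum>q\<in>{s<..<t}. seg t i \<star> (seg q j \<star> seg s k) \<star> T q) =
      (\<Sum>q\<in>{s<..t - 1}. seg t i \<star> seg s k \<star> seg q j \<star> T q)"
    by (rule sum.cong) (auto simp: times_ac)
  have 3: "(\<Sum>u\<in>{t<..n}. seg u i \<star> (seg t j \<star> seg s k) \<star> T u) =
      (\<Sum>u\<in>{t<..n}. seg t j \<star> seg s k \<star> seg u i \<star> T u)"
    by (rule sum.cong) (auto simp: times_ac)
  have 4: "carry s j k \<star> seg t i \<star> N s = seg t i \<star> (carry s j k \<star> N s)"
    "carry t i j \<star> seg s k \<star> N t = seg s k \<star> (carry t i j \<star> N t)"
    by (simp_all add: times_ac)
  have le: "0 \<le> s - 1" "s \<le> t - 1" "t \<le> n" using t by auto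
  show ?thesis
    unfolding 1 2 3 4 carry_N[OF s] carry_N[OF t']
      sum_times_seg_T[OF times_closed[OF seg_closed seg_closed] le(1)]
      sum_times_seg_T[OF times_closed[OF seg_closed seg_closed] le(2)]
      sum_times_seg_T[OF times_closed[OF seg_closed seg_closed] le(3)]
    by (simp add: zg_mult_distribs times_ac)
qed

lemma tensor_d_F3_value:
  "tensor_d G n m g (F3_value G n m g i j k) =
     pre n i \<bullet>\<^bsub>G\<^esub> F2_value G n m g j k - F2_value G n m g (add_exp i j) k
     + F2_value G n m g i (add_exp j k) - F2_value G n m g i j"
proof -
  let ?X = "\<lambda>r s t. seg t i \<star> (seg s j \<star> seg r k)"
  have "tensor_d G n m g (F3_value G n m g i j k) =
      (\<Sum>r=1..n. \<phi> [r, r] (carry r j k \<star> seg r i \<star> T r))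
      + (\<Sum>r=1..n. \<Sum>t\<in>{r<..n}.
          \<phi> [r, t] (carry r j k \<star> seg t i \<star> N r) + \<phi> [r, r] (carry r j k \<star> seg t i \<star> T t))
      + (\<Sum>r=1..n. \<Sum>t\<in>{r<..n}.
          \<phi> [t, t] (carry t i j \<star> seg r k \<star> T r) - \<phi> [r, t] (carry t i j \<star> seg r k \<star> N t))
      - (\<Sum>r=1..n. \<Sum>s\<in>{r<..n}. \<Sum>t\<in>{s<..n}.
          \<phi> [s, t] (?X r s t \<star> T r) - \<phi> [r, t] (?X r s t \<star> T s) + \<phi> [r, s] (?X r s t \<star> T t))"
    unfolding F3_value_eq tensor_d_simps
    by (intro arg_cong2[where f = minus] arg_cong2[where f = plus] sum.cong refl tensor_d_phi_3_eq
          tensor_d_phi_3_eq_less tensor_d_phi_3_less_eq tensor_d_phi_3_less) auto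
  \<comment> \<open>Regrouping by generator: the deleted index becomes innermost, as
    \<open>r\<close>, \<open>q\<close> or \<open>u\<close> according to its place in the
    triple.\<close>
  also have "\<dots> =
      (\<Sum>s=1..n. \<phi> [s, s] (carry s j k \<star> seg s i \<star> T s + (\<Sum>t\<in>{s<..n}. carry s j k \<star> seg t i \<star> T t)
         + (\<Sum>r\<in>{1..<s}. carry s i j \<star> seg r k \<star> T r)))
      + (\<Sum>s=1..n. \<Sum>t\<in>{s<..n}. \<phi> [s, t] (carry s j k \<star> seg t i \<star> N s - carry t i j \<star> seg s k \<star> N t
         - (\<Sum>r\<in>{1..<s}. ?X r s t \<star> T r) + (\<Sum>q\<in>{s<..<t}. ?X s q t \<star> T q)
         - (\<Sum>u\<in>{t<..n}. ?X s t u \<star> T u)))"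
    unfolding sum_subtractf sum.distrib single_add single_diff single_sum
      sum_less_pairs_swap[where f = "\<lambda>r t. \<phi> [t, t] (carry t i j \<star> seg r k \<star> T r)"]
      sum_less_triples_rotate[where f = "\<lambda>r s t. \<phi> [s, t] (?X r s t \<star> T r)"]
      sum_less_triples_mid[where f = "\<lambda>r s t. \<phi> [r, t] (?X r s t \<star> T s)"]
    by simp
  also have "\<dots> =
      (\<Sum>s=1..n. \<phi> [s, s] (pre n i \<star> carry s j k - carry s (add_exp i j) k
         + carry s i (add_exp j k) - carry s i j))
      + (\<Sum>s=1..n. \<Sum>t\<in>{s<..n}. \<phi> [s, t] (seg s k \<star> seg t (add_exp i j) - pre n i \<star> (seg s k \<star> seg t j)
         - seg s (add_exp j k) \<star> seg t i + seg s j \<star> seg t i))"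
    by (intro arg_cong2[where f = plus] sum.cong refl arg_cong[where f = "Poly_Mapping.single _"]
          tensor_d_F3_value_coeff_eq tensor_d_F3_value_coeff_less)
  also have "\<dots> = pre n i \<bullet>\<^bsub>G\<^esub> F2_value G n m g j k - F2_value G n m g (add_exp i j) k
     + F2_value G n m g i (add_exp j k) - F2_value G n m g i j"
    unfolding F2_value_eq zg_smult_diff_right zg_smult_sum_right zg_smult_single
      sum_subtractf sum.distrib single_add single_diff
    by simp
  finally show ?thesis .
qed

end


section \<open>The comparison maps\<close>

lemma bar_closed [intro]:
  assumes "monoid G" "set hs \<subseteq> carrier G" "length hs = p"
  shows "bar G hs \<in> carrier (bar_module G p)"
  using assms monoid.one_closed[OF assms(1)]
  unfolding bar_def bar_module_def by (auto intro!: free_zg_module_closed)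

lemma tensor_d_module_hom:
  assumes "monoid G" and g: "\<And>l. g l \<in> carrier G"
  shows "tensor_d G n m g \<in> module_hom (group_ring G) (tensor_module G n (Suc p)) (tensor_module G n p)"
  unfolding tensor_d_eq_zg_linear tensor_module_def
proof (intro zg_linear_module_hom free_zg_module_sum_closed)
  interpret monoid G by fact
  have N: "N_elt G m g i \<in> carrier (group_ring G)" for i
    unfolding N_elt_def using g by (intro group_ring_sum_closed) auto
  have T: "T_elt G g i \<in> carrier (group_ring G)" for i
    using g by (auto simp: T_elt_def)
  fix a i assume a: "a \<in> {a. (\<forall>l. l \<notin> {1..n} \<longrightarrow> a l = 0) \<and> (\<Sum>l=1..n. a l) = Suc p}" and i: "i \<in> {1..n}"
  show "tensor_d_part G m g i a
    \<in> carrier (free_zg_module G {a. (\<forall>l. l \<notin> {1..n} \<longrightarrow> a l = 0) \<and> (\<Sum>l=1..n. a l) = p})"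
  proof (cases "a i = 0")
    case False
    \<comment> \<open>Position \<open>i\<close> is split off; as \<open>a i\<close> is nonzero, the
      natural number \<open>a i - 1\<close> really lowers the degree by one.\<close>
    have "(\<Sum>l=1..n. a l) = a i + (\<Sum>l\<in>{1..n} - {i}. a l)"
      using i by (simp add: sum.remove)
    moreover have "(\<Sum>l=1..n. (a(i := a i - 1)) l) = a i - 1 + (\<Sum>l\<in>{1..n} - {i}. a l)"
      using i by (simp add: sum.remove)
    ultimately have "(\<Sum>l=1..n. (a(i := a i - 1)) l) = p"
      using a False by simp
    then have "Phi_seq G (a(i := a i - 1))
      \<in> carrier (free_zg_module G {a. (\<forall>l. l \<notin> {1..n} \<longrightarrow> a l = 0) \<and> (\<Sum>l=1..n. a l) = p})"
      unfolding Phi_seq_def using a i by (intro free_zg_module_closed) auto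
    then show ?thesis
      using False N T assms(1) by (auto simp: tensor_d_part_def intro!: zg_smult_closed)
  qed (simp add: tensor_d_part_def)
qed fact

lemma bar_d_module_hom:
  assumes "monoid G"
  shows bar_d1_module_hom: "bar_d1 G \<in> module_hom (group_ring G) (bar_module G 1) (bar_module G 0)"
    and bar_d2_module_hom: "bar_d2 G \<in> module_hom (group_ring G) (bar_module G 2) (bar_module G 1)"
    and bar_d3_module_hom: "bar_d3 G \<in> module_hom (group_ring G) (bar_module G 3) (bar_module G 2)"
proof -
  interpret monoid G by fact
  have bar: "set hs \<subseteq> carrier G \<Longrightarrow> length hs = p \<Longrightarrow> bar G hs \<in>
    carrier (free_zg_module G {hs. length hs = p \<and> set hs \<subseteq> carrier G - {\<one>\<^bsub>G\<^esub>}})" for hs p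
    using bar_closed[OF assms, of hs p] by (simp add: bar_module_def)
  show "bar_d1 G \<in> module_hom (group_ring G) (bar_module G 1) (bar_module G 0)"
    unfolding bar_d1_def bar_module_def
    by (intro zg_linear_module_hom zg_smult_closed free_zg_module_closed group_ring_closed bar assms)
       (auto simp: length_Suc_conv)
  show "bar_d2 G \<in> module_hom (group_ring G) (bar_module G 2) (bar_module G 1)"
    unfolding bar_d2_def bar_module_def
    by (intro zg_linear_module_hom zg_smult_closed free_zg_module_closed group_ring_closed bar assms)
       (auto simp: length_Suc_conv eval_nat_numeral)
  show "bar_d3 G \<in> module_hom (group_ring G) (bar_module G 3) (bar_module G 2)"
    unfolding bar_d3_def bar_module_def
    by (intro zg_linear_module_hom zg_smult_closed free_zg_module_closed group_ring_closed bar assms)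
       (auto simp: length_Suc_conv eval_nat_numeral)
qed

context cyclic_decomposition
begin

lemma phi_closed:
  "set L \<subseteq> {1..n} \<Longrightarrow> length L = p \<Longrightarrow> c \<in> ZG \<Longrightarrow> \<phi> L c \<in> carrier (tensor_module G n p)"
  unfolding tensor_module_def
  by (intro free_zg_module_closed) (auto simp: sum_count_set count_list_0_iff)

lemma F1_value_closed: "F1_value G n g i \<in> carrier (tensor_module G n 1)"
  unfolding F1_value_eq unfolding tensor_module_def
  by (intro phi_closed[unfolded tensor_module_def] free_zg_module_sum_closed free_zg_module_closed(3,4)) auto

lemma F2_value_closed: "F2_value G n m g i j \<in> carrier (tensor_module G n 2)"
  unfolding F2_value_eq unfolding tensor_module_def
  by (intro phi_closed[unfolded tensor_module_def] free_zg_module_sum_closed free_zg_module_closed(3,4)) auto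

lemma F3_value_closed: "F3_value G n m g i j k \<in> carrier (tensor_module G n 3)"
  unfolding F3_value_eq unfolding tensor_module_def
  by (intro phi_closed[unfolded tensor_module_def] free_zg_module_sum_closed free_zg_module_closed(3,4)) auto

text \<open>A group element fixes its exponent vector only on \<open>{1..n}\<close>, so the
  prescribed values must depend on nothing else; the following congruences carry this up to degree
  3.\<close>

lemma seg_cong:
  assumes "\<And>l. l \<in> {1..n} \<Longrightarrow> i l = i' l" "s \<in> {1..n}"
  shows "seg s i = seg s i'"
proof -
  have "gmon G g (s - 1) i = gmon G g (s - 1) i'" by (rule gmon_cong) (use assms in auto)
  then show ?thesis using assms by (simp add: seg_def)
qed

lemma carry_cong:
  assumes "\<And>l. l \<in> {1..n} \<Longrightarrow> i l = i' l" "\<And>l. l \<in> {1..n} \<Longrightarrow> j l = j' l" "s \<in> {1..n}"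
  shows "carry s i j = carry s i' j'"
proof -
  have "gmon G g (s - 1) (\<lambda>l. i l + j l) = gmon G g (s - 1) (\<lambda>l. i' l + j' l)"
    by (rule gmon_cong) (use assms in auto)
  then show ?thesis using assms by (simp add: carry_def)
qed

lemma F1_value_cong:
  "(\<And>l. l \<in> {1..n} \<Longrightarrow> i l = i' l) \<Longrightarrow> F1_value G n g i = F1_value G n g i'"
  unfolding F1_value_eq
  by (intro sum.cong refl arg_cong[where f = "Poly_Mapping.single _"] seg_cong) auto

lemma F2_value_cong:
  "(\<And>l. l \<in> {1..n} \<Longrightarrow> i l = i' l) \<Longrightarrow> (\<And>l. l \<in> {1..n} \<Longrightarrow> j l = j' l) \<Longrightarrow>
    F2_value G n m g i j = F2_value G n m g i' j'"
  unfolding F2_value_eq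
  by (intro sum.cong refl arg_cong[where f = "Poly_Mapping.single _"] arg_cong2[where f = minus]
      arg_cong2[where f = "zg_mult G"] seg_cong carry_cong) auto

lemma F3_value_cong:
  "(\<And>l. l \<in> {1..n} \<Longrightarrow> i l = i' l) \<Longrightarrow> (\<And>l. l \<in> {1..n} \<Longrightarrow> j l = j' l) \<Longrightarrow>
    (\<And>l. l \<in> {1..n} \<Longrightarrow> k l = k' l) \<Longrightarrow> F3_value G n m g i j k = F3_value G n m g i' j' k'"
  unfolding F3_value_eq
  by (intro sum.cong refl arg_cong[where f = "Poly_Mapping.single _"] arg_cong2[where f = minus]
      arg_cong2[where f = plus] arg_cong2[where f = "zg_mult G"] seg_cong carry_cong) auto

section \<open>Vanishing on degenerate symbols\<close>

lemma seg_eq_0: "e s = 0 \<Longrightarrow> seg s e = 0"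
  by (simp add: seg_def)

text \<open>The remaining summand \<open>j s\<close> is reduced, hence below \<open>m s\<close>, and
  produces no carry.\<close>

lemma carry_eq_0_left: "j \<in> exponents n m \<Longrightarrow> s \<in> {1..n} \<Longrightarrow> i s = 0 \<Longrightarrow> carry s i j = 0"
  by (simp add: carry_def exponents_def)

lemma carry_eq_0_right: "i \<in> exponents n m \<Longrightarrow> s \<in> {1..n} \<Longrightarrow> j s = 0 \<Longrightarrow> carry s i j = 0"
  by (simp add: carry_def exponents_def)

text \<open>Uniqueness of exponents against the zero vector, which is reduced because the
  \<open>m l\<close> are positive.\<close>

lemma gmon_eq_one_imp:
  assumes "e \<in> exponents n m" "gmon G g n e = \<one>" "l \<in> {1..n}"
  shows "e l = 0"
  using gmon_inj[of e "\<lambda>_. 0" l] assms m_pos by (auto simp: exponents_def)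

lemma F1_value_degenerate:
  assumes "i \<in> exponents n m" "gmon G g n i = \<one>"
  shows "F1_value G n g i = 0"
  using gmon_eq_one_imp[OF assms] by (simp add: F1_value_eq seg_eq_0)

lemma F2_value_degenerate:
  assumes "i \<in> exponents n m" "j \<in> exponents n m" "gmon G g n i = \<one> \<or> gmon G g n j = \<one>"
  shows "F2_value G n m g i j = 0"
  using assms(3)
proof
  assume "gmon G g n i = \<one>"
  then show ?thesis
    using gmon_eq_one_imp[OF assms(1)] assms by (simp add: F2_value_eq seg_eq_0 carry_eq_0_left)
next
  assume "gmon G g n j = \<one>"
  then show ?thesis
    using gmon_eq_one_imp[OF assms(2)] assms by (simp add: F2_value_eq seg_eq_0 carry_eq_0_right)
qed

text \<open>Every summand involves each of the three arguments through a \<open>seg\<close> or a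
  \<open>carry\<close>, and either one vanishes when that argument has all exponents 0.\<close>

lemma F3_value_degenerate:
  assumes "i \<in> exponents n m" "j \<in> exponents n m" "k \<in> exponents n m"
    and "gmon G g n i = \<one> \<or> gmon G g n j = \<one> \<or> gmon G g n k = \<one>"
  shows "F3_value G n m g i j k = 0"
proof -
  consider "gmon G g n i = \<one>" | "gmon G g n j = \<one>" | "gmon G g n k = \<one>" using assms by blast
  then show ?thesis
  proof cases
    case 1
    then show ?thesis
      using gmon_eq_one_imp[OF assms(1)] assms by (simp add: F3_value_eq seg_eq_0 carry_eq_0_left)
  next
    case 2
    then show ?thesis
      using gmon_eq_one_imp[OF assms(2)] assms
      by (simp add: F3_value_eq seg_eq_0 carry_eq_0_left carry_eq_0_right)
  next
    case 3
    then show ?thesis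
      using gmon_eq_one_imp[OF assms(3)] assms by (simp add: F3_value_eq seg_eq_0 carry_eq_0_right)
  qed
qed

text \<open>A discrete logarithm for the generators \<open>g l\<close>; its values outside
  \<open>{1..n}\<close> are arbitrary.\<close>

definition dlog :: "'a \<Rightarrow> nat \<Rightarrow> nat" where
  "dlog h = (SOME e. e \<in> exponents n m \<and> gmon G g n e = h)"

lemma dlog:
  assumes "h \<in> carrier G" shows "dlog h \<in> exponents n m" "gmon G g n (dlog h) = h"
proof -
  have "dlog h \<in> exponents n m \<and> gmon G g n (dlog h) = h"
    unfolding dlog_def
    by (rule someI_ex[of "\<lambda>e. e \<in> exponents n m \<and> gmon G g n e = h"])
       (use gmon_surj[OF assms] in blast)
  then show "dlog h \<in> exponents n m" "gmon G g n (dlog h) = h" by auto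
qed

lemma dlog_gmon: "e \<in> exponents n m \<Longrightarrow> l \<in> {1..n} \<Longrightarrow> dlog (gmon G g n e) l = e l"
  by (rule gmon_inj) (simp_all add: dlog)

text \<open>The prescribed values, read off through \<open>dlog\<close>, are extended linearly. On
  nondegenerate symbols the congruences remove the choice in \<open>dlog\<close>; on degenerate ones
  the symbol is 0 and the prescribed value vanishes too.\<close>

lemma comparison_maps_exist: "\<exists>F0 F1 F2 F3. comparison_maps G n m g F0 F1 F2 F3"
proof (intro exI)
  let ?F0 = "zg_linear G (\<lambda>_. Phi_seq G (\<lambda>_. 0))"
  let ?F1 = "zg_linear G (\<lambda>hs. F1_value G n g (dlog (hs ! 0)))"
  let ?F2 = "zg_linear G (\<lambda>hs. F2_value G n m g (dlog (hs ! 0)) (dlog (hs ! 1)))"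
  let ?F3 = "zg_linear G (\<lambda>hs. F3_value G n m g (dlog (hs ! 0)) (dlog (hs ! 1)) (dlog (hs ! 2)))"
  have 1: "Phi_seq G (\<lambda>_. 0) \<in> carrier (tensor_module G n 0)"
    using phi_closed[of "[]" 0 "frag_of \<one>"] by (simp add: Phi_seq_def count_list_Nil_eq)
  \<comment> \<open>Closure can be asked for every list, since the values lie in the tensor module
    for arbitrary exponent functions, even where \<open>hs ! 0\<close> is unspecified.\<close>
  have hom: "zg_linear G f \<in> module_hom (group_ring G) (bar_module G p) (tensor_module G n q)"
    if "\<And>hs. f hs \<in> carrier (tensor_module G n q)" for f p q
    unfolding bar_module_def tensor_module_def
    by (rule zg_linear_module_hom[OF monoid_G]) (use that in \<open>simp add: tensor_module_def\<close>)
  have one: "frag_of \<one> \<bullet>\<^bsub>G\<^esub> v = v" if "v \<in> carrier (tensor_module G n q)" for v q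
    using that unfolding tensor_module_def by (rule zg_smult_one[OF monoid_G])
  note closed = 1 F1_value_closed F2_value_closed F3_value_closed
  have "?F1 (bar G [gmon G g n i]) = F1_value G n g i" if "i \<in> exponents n m" for i
  proof (cases "gmon G g n i = \<one>")
    case False
    have "F1_value G n g (dlog (gmon G g n i)) = F1_value G n g i"
      by (rule F1_value_cong) (simp_all add: dlog_gmon that)
    then show ?thesis using False by (auto simp: bar_def one[OF F1_value_closed])
  qed (use that in \<open>simp add: bar_def F1_value_degenerate\<close>)
  moreover have "?F2 (bar G [gmon G g n i, gmon G g n j]) = F2_value G n m g i j"
    if "i \<in> exponents n m" "j \<in> exponents n m" for i j
  proof (cases "gmon G g n i = \<one> \<or> gmon G g n j = \<one>")
    case False
    have "F2_value G n m g (dlog (gmon G g n i)) (dlog (gmon G g n j)) = F2_value G n m g i j"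
      by (rule F2_value_cong) (simp_all add: dlog_gmon that)
    then show ?thesis using False by (auto simp: bar_def one[OF F2_value_closed])
  qed (use that in \<open>auto simp: bar_def F2_value_degenerate\<close>)
  moreover have "?F3 (bar G [gmon G g n i, gmon G g n j, gmon G g n k]) = F3_value G n m g i j k"
    if "i \<in> exponents n m" "j \<in> exponents n m" "k \<in> exponents n m" for i j k
  proof (cases "gmon G g n i = \<one> \<or> gmon G g n j = \<one> \<or> gmon G g n k = \<one>")
    case False
    have "F3_value G n m g (dlog (gmon G g n i)) (dlog (gmon G g n j)) (dlog (gmon G g n k)) = F3_value G n m g i j k"
      by (rule F3_value_cong) (simp_all add: dlog_gmon that)
    then show ?thesis using False by (auto simp: bar_def one[OF F3_value_closed])
  qed (use that in \<open>auto simp: bar_def F3_value_degenerate\<close>)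
  moreover have "?F0 (bar G []) = Phi_seq G (\<lambda>_. 0)"
    by (simp add: bar_def one[OF 1])
  ultimately show "comparison_maps G n m g ?F0 ?F1 ?F2 ?F3"
    unfolding comparison_maps_def by (intro conjI ballI hom closed) simp_all
qed

text \<open>Each free generator is a tuple of nontrivial monomials with reduced exponents, so
  homomorphisms need only be compared on symbols with a prescribed value.\<close>

lemma bar_module_hom_eqI:
  assumes "F \<in> module_hom (group_ring G) (bar_module G p) (tensor_module G n q)"
    and "F' \<in> module_hom (group_ring G) (bar_module G p) (tensor_module G n q)"
    and "\<And>es. length es = p \<Longrightarrow> set es \<subseteq> exponents n m \<Longrightarrow> \<one> \<notin> set (map (gmon G g n) es) \<Longrightarrow>
      F (bar G (map (gmon G g n) es)) = F' (bar G (map (gmon G g n) es))"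
    and "v \<in> carrier (bar_module G p)"
  shows "F v = F' v"
proof (rule module_hom_free_eqI[OF comm_group_axioms assms(1,2)[unfolded bar_module_def tensor_module_def]])
  fix hs assume "hs \<in> {hs. length hs = p \<and> set hs \<subseteq> carrier G - {\<one>}}"
  then have hs: "length hs = p" "set hs \<subseteq> carrier G" "\<one> \<notin> set hs" by auto
  define es where "es = map dlog hs"
  have es: "hs = map (gmon G g n) es" "set es \<subseteq> exponents n m"
    unfolding es_def map_map using hs(2) by (auto simp: dlog map_idI[symmetric] subset_iff)
  then show "F (Poly_Mapping.single hs (frag_of \<one>)) = F' (Poly_Mapping.single hs (frag_of \<one>))"
    using assms(3)[of es] hs by (auto simp: bar_def)
qed (use assms in \<open>simp add: bar_module_def\<close>)

section \<open>The chain map equations for arbitrary comparison maps\<close>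

context
  fixes F0 F1 F2 F3
  assumes cm: "comparison_maps G n m g F0 F1 F2 F3"
begin

lemma F_hom:
  "F0 \<in> module_hom (group_ring G) (bar_module G 0) (tensor_module G n 0)"
  "F1 \<in> module_hom (group_ring G) (bar_module G 1) (tensor_module G n 1)"
  "F2 \<in> module_hom (group_ring G) (bar_module G 2) (tensor_module G n 2)"
  "F3 \<in> module_hom (group_ring G) (bar_module G 3) (tensor_module G n 3)"
  using cm by (auto simp: comparison_maps_def)

lemma F_bar:
  "F0 (bar G []) = \<phi> [] (frag_of \<one>)"
  "i \<in> exponents n m \<Longrightarrow> F1 (bar G [gmon G g n i]) = F1_value G n g i"
  "i \<in> exponents n m \<Longrightarrow> j \<in> exponents n m \<Longrightarrow>
     F2 (bar G [gmon G g n i, gmon G g n j]) = F2_value G n m g i j"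
  "i \<in> exponents n m \<Longrightarrow> j \<in> exponents n m \<Longrightarrow> k \<in> exponents n m \<Longrightarrow>
     F3 (bar G [gmon G g n i, gmon G g n j, gmon G g n k]) = F3_value G n m g i j k"
  using cm by (auto simp: comparison_maps_def Phi_seq_def count_list_Nil_eq)

text \<open>The empty list is the only generator in degree 0, so \<open>v\<close> is determined by
  one coefficient.\<close>

lemma F0_eq:
  assumes "v \<in> carrier (bar_module G 0)"
  shows "F0 v = \<phi> [] (Poly_Mapping.lookup v [])"
proof -
  have v: "v \<in> carrier (free_zg_module G {hs. length hs = 0 \<and> set hs \<subseteq> carrier G - {\<one>}})"
    using assms by (simp add: bar_module_def)
  have keys: "Poly_Mapping.keys v \<subseteq> {[]}" and L: "Poly_Mapping.lookup v [] \<in> ZG"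
    using v by (auto simp: carrier_free_zg_module)
  have "F0 v = zg_linear G (\<lambda>b. F0 (Poly_Mapping.single b (frag_of \<one>))) v"
    by (rule module_hom_eq_zg_linear[OF comm_group_axioms F_hom(1)[unfolded bar_module_def tensor_module_def] v])
  also have "\<dots> = Poly_Mapping.lookup v [] \<bullet>\<^bsub>G\<^esub> F0 (bar G [])"
    by (subst zg_linear_superset[OF _ keys]) (simp_all add: bar_def)
  finally show ?thesis using L by (simp add: F_bar)
qed

text \<open>Only the generator changes, not its coefficient, and the augmentation sends both
  generators to 1.\<close>

lemma augmentation_F0:
  assumes "v \<in> carrier (bar_module G 0)"
  shows "augmentation (F0 v) = augmentation v"
proof -
  have "Poly_Mapping.keys v \<subseteq> {[]}"
    using assms by (auto simp: bar_module_def carrier_free_zg_module)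
  then have "Poly_Mapping.lookup v b = 0" if "b \<noteq> []" for b
    using that by (auto simp: in_keys_iff)
  then have "v = Poly_Mapping.single [] (Poly_Mapping.lookup v [])"
    by (intro poly_mapping_eqI) (simp add: lookup_single when_def)
  then have "augmentation v = augmentation (Poly_Mapping.single [] (Poly_Mapping.lookup v []) :: 'a list \<Rightarrow>\<^sub>0 _)"
    by simp
  then show ?thesis
    by (simp add: F0_eq[OF assms] augmentation_def)
qed

lemma tensor_d_F1:
  assumes "v \<in> carrier (bar_module G 1)"
  shows "tensor_d G n m g (F1 v) = F0 (bar_d1 G v)"
proof (rule bar_module_hom_eqI[OF _ _ _ assms])
  show "(\<lambda>v. tensor_d G n m g (F1 v)) \<in> module_hom (group_ring G) (bar_module G 1) (tensor_module G n 0)"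
    by (rule module_hom_compose[OF F_hom(2)]) (use tensor_d_module_hom[OF monoid_G, of g n m 0] in simp)
  show "(\<lambda>v. F0 (bar_d1 G v)) \<in> module_hom (group_ring G) (bar_module G 1) (tensor_module G n 0)"
    by (rule module_hom_compose[OF bar_d1_module_hom[OF monoid_G] F_hom(1)])
  fix es assume "length es = 1" "set es \<subseteq> exponents n m" "\<one> \<notin> set (map (gmon G g n) es)"
  then obtain i where es: "es = [i]" and i: "i \<in> exponents n m" and "\<one> \<noteq> gmon G g n i"
    by (auto simp: length_Suc_conv)
  then have "bar_d1 G (bar G [gmon G g n i]) = Poly_Mapping.single [] (pre n i - frag_of \<one>)"
    by (simp add: bar_d1_def bar_def pre_def)
  moreover have "Poly_Mapping.single [] (pre n i - frag_of \<one>) \<in> carrier (bar_module G 0)"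
    by (auto simp: bar_module_def)
  ultimately show "tensor_d G n m g (F1 (bar G (map (gmon G g n) es))) =
      F0 (bar_d1 G (bar G (map (gmon G g n) es)))"
    by (simp add: es F_bar(2)[OF i] tensor_d_F1_value F0_eq)
qed

lemma tensor_d_F2:
  assumes "v \<in> carrier (bar_module G 2)"
  shows "tensor_d G n m g (F2 v) = F1 (bar_d2 G v)"
proof (rule bar_module_hom_eqI[OF _ _ _ assms])
  show "(\<lambda>v. tensor_d G n m g (F2 v)) \<in> module_hom (group_ring G) (bar_module G 2) (tensor_module G n 1)"
    by (rule module_hom_compose[OF F_hom(3)])
       (use tensor_d_module_hom[OF monoid_G, of g n m 1] in \<open>simp add: numeral_2_eq_2\<close>)
  show "(\<lambda>v. F1 (bar_d2 G v)) \<in> module_hom (group_ring G) (bar_module G 2) (tensor_module G n 1)"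
    by (rule module_hom_compose[OF bar_d2_module_hom[OF monoid_G] F_hom(2)])
  fix es assume "length es = 2" "set es \<subseteq> exponents n m" "\<one> \<notin> set (map (gmon G g n) es)"
  then obtain i j where es: "es = [i, j]" and ij: "i \<in> exponents n m" "j \<in> exponents n m"
    and "\<one> \<noteq> gmon G g n i" "\<one> \<noteq> gmon G g n j"
    by (auto simp: length_Suc_conv numeral_2_eq_2)
  let ?b = "\<lambda>e. bar G [gmon G g n e]"
  have b: "?b e \<in> carrier (bar_module G 1)" for e
    by (rule bar_closed[OF monoid_G]) auto
  note b' = b[unfolded bar_module_def]
  note hom = F_hom(2)[unfolded bar_module_def tensor_module_def]
  note closed = zg_smult_closed[OF monoid_G pre_closed b'] b' free_zg_module_closed(3,4)
  \<comment> \<open>The unit scalar is the coefficient of the two-entry symbol. One-entry symbols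
    stay folded, since \<open>add_exp i j\<close> may give the group unit.\<close>
  have "bar_d2 G (bar G [gmon G g n i, gmon G g n j]) =
      frag_of \<one> \<bullet>\<^bsub>G\<^esub> (pre n i \<bullet>\<^bsub>G\<^esub> ?b j - ?b (add_exp i j) + ?b i)"
    using es \<open>\<one> \<noteq> gmon G g n i\<close> \<open>\<one> \<noteq> gmon G g n j\<close>
    by (simp add: bar_d2_def bar_def[of G "[_, _]"] pre_def gmon_add_exp)
  also have "\<dots> = pre n i \<bullet>\<^bsub>G\<^esub> ?b j - ?b (add_exp i j) + ?b i"
    by (intro zg_smult_one[OF monoid_G,
          where S = "{hs. length hs = 1 \<and> set hs \<subseteq> carrier G - {\<one>}}"] closed)
  finally have "F1 (bar_d2 G (bar G [gmon G g n i, gmon G g n j])) =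
      pre n i \<bullet>\<^bsub>G\<^esub> F1 (?b j) - F1 (?b (add_exp i j)) + F1 (?b i)"
    by (simp add: module_hom_add[OF hom] module_hom_diff[OF hom] module_hom_smult[OF hom] closed
        del: One_nat_def)
  then show "tensor_d G n m g (F2 (bar G (map (gmon G g n) es))) =
      F1 (bar_d2 G (bar G (map (gmon G g n) es)))"
    by (simp add: es F_bar ij tensor_d_F2_value)
qed

lemma tensor_d_F3:
  assumes "v \<in> carrier (bar_module G 3)"
  shows "tensor_d G n m g (F3 v) = F2 (bar_d3 G v)"
proof (rule bar_module_hom_eqI[OF _ _ _ assms])
  show "(\<lambda>v. tensor_d G n m g (F3 v)) \<in> module_hom (group_ring G) (bar_module G 3) (tensor_module G n 2)"
    by (rule module_hom_compose[OF F_hom(4)])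
       (use tensor_d_module_hom[OF monoid_G, of g n m 2] in \<open>simp add: eval_nat_numeral\<close>)
  show "(\<lambda>v. F2 (bar_d3 G v)) \<in> module_hom (group_ring G) (bar_module G 3) (tensor_module G n 2)"
    by (rule module_hom_compose[OF bar_d3_module_hom[OF monoid_G] F_hom(3)])
  fix es assume "length es = 3" "set es \<subseteq> exponents n m" "\<one> \<notin> set (map (gmon G g n) es)"
  then obtain i j k where es: "es = [i, j, k]"
    and ijk: "i \<in> exponents n m" "j \<in> exponents n m" "k \<in> exponents n m"
    and "\<one> \<noteq> gmon G g n i" "\<one> \<noteq> gmon G g n j" "\<one> \<noteq> gmon G g n k"
    by (auto simp: length_Suc_conv eval_nat_numeral)
  let ?b = "\<lambda>e e'. bar G [gmon G g n e, gmon G g n e']"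
  have b: "?b e e' \<in> carrier (bar_module G 2)" for e e'
    by (rule bar_closed[OF monoid_G]) auto
  note b' = b[unfolded bar_module_def]
  note hom = F_hom(3)[unfolded bar_module_def tensor_module_def]
  note closed = zg_smult_closed[OF monoid_G pre_closed b'] b' free_zg_module_closed(3,4)
  \<comment> \<open>Products of entries are again reduced monomials via \<open>add_exp\<close>, so
    every symbol on the right has a prescribed value, degenerate or not.\<close>
  have "bar_d3 G (bar G [gmon G g n i, gmon G g n j, gmon G g n k]) =
      frag_of \<one> \<bullet>\<^bsub>G\<^esub>
        (pre n i \<bullet>\<^bsub>G\<^esub> ?b j k - ?b (add_exp i j) k + ?b i (add_exp j k) - ?b i j)"
    using es \<open>\<one> \<noteq> gmon G g n i\<close> \<open>\<one> \<noteq> gmon G g n j\<close> \<open>\<one> \<noteq> gmon G g n k\<close>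
    by (simp add: bar_d3_def bar_def[of G "[_, _, _]"] pre_def gmon_add_exp)
  also have "\<dots> = pre n i \<bullet>\<^bsub>G\<^esub> ?b j k - ?b (add_exp i j) k + ?b i (add_exp j k) - ?b i j"
    by (intro zg_smult_one[OF monoid_G,
          where S = "{hs. length hs = 2 \<and> set hs \<subseteq> carrier G - {\<one>}}"] closed)
  finally have "F2 (bar_d3 G (bar G [gmon G g n i, gmon G g n j, gmon G g n k])) =
      pre n i \<bullet>\<^bsub>G\<^esub> F2 (?b j k) - F2 (?b (add_exp i j) k) + F2 (?b i (add_exp j k)) - F2 (?b i j)"
    by (simp add: module_hom_add[OF hom] module_hom_diff[OF hom] module_hom_smult[OF hom] closed)
  then show "tensor_d G n m g (F3 (bar G (map (gmon G g n) es))) =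
      F2 (bar_d3 G (bar G (map (gmon G g n) es)))"
    by (simp add: es F_bar ijk tensor_d_F3_value)
qed

end

end


section \<open>Products of cyclic groups\<close>

text \<open>A generator reaches \<open>y\<close> by some integer multiple \<open>q\<close>; the
  residue of \<open>q\<close> modulo \<open>m\<close> serves as the natural exponent.\<close>

lemma integer_mod_group_generator_mult:
  fixes x :: int
  assumes "1 \<le> m" "x \<in> carrier (integer_mod_group m)"
    and "generate (integer_mod_group m) {x} = carrier (integer_mod_group m)"
    and "y \<in> carrier (integer_mod_group m)"
  obtains e where "e < m" "(int e * x) mod int m = y"
proof -
  have "y \<in> {x [^]\<^bsub>integer_mod_group m\<^esub> (q :: int) |q. q \<in> UNIV}"
    using group.generate_pow[OF group_integer_mod_group assms(2)] assms(3,4) by auto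
  then obtain q :: int where q: "y = (q * x) mod int m"
    by (auto simp: int_pow_integer_mod_group)
  show thesis
  proof
    show "nat (q mod int m) < m" using assms(1) by (simp add: nat_less_iff)
    show "(int (nat (q mod int m)) * x) mod int m = y"
      using assms(1) by (simp add: q mod_mult_left_eq)
  qed
qed

text \<open>A generator is invertible modulo \<open>m\<close>: multiplying by \<open>e\<close> with
  \<open>e * x\<close> congruent to 1 recovers \<open>c\<close> from \<open>c * x\<close>.\<close>

lemma integer_mod_group_generator_cancel:
  fixes x :: int
  assumes "1 \<le> m" "x \<in> carrier (integer_mod_group m)"
    and "generate (integer_mod_group m) {x} = carrier (integer_mod_group m)"
    and "a < m" "b < m" "(int a * x) mod int m = (int b * x) mod int m"
  shows "a = b"
proof -
  \<comment> \<open>The residue \<open>1 mod int m\<close> rather than 1 also covers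
    \<open>m = 1\<close>, where the carrier is \<open>{0}\<close>.\<close>
  have "1 mod int m \<in> carrier (integer_mod_group m)"
    using assms(1) by (simp add: carrier_integer_mod_group)
  then obtain e where e: "(int e * x) mod int m = 1 mod int m"
    using integer_mod_group_generator_mult[OF assms(1-3)] by blast
  have "int c mod int m = (int e * ((int c * x) mod int m)) mod int m" for c
  proof -
    have "(int e * ((int c * x) mod int m)) mod int m = (int c * ((int e * x) mod int m)) mod int m"
      by (simp add: mod_mult_right_eq mult.left_commute)
    also have "\<dots> = int c mod int m"
      unfolding e by (simp add: mod_mult_right_eq)
    finally show ?thesis by simp
  qed
  from this[of a] this[of b] show ?thesis using assms(4-6) by simp
qed

lemma comm_group_product_group:
  assumes "\<And>i. i \<in> I \<Longrightarrow> comm_group (H i)"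
  shows "comm_group (product_group I H)"
proof (rule group.group_comm_groupI)
  show "group (product_group I H)"
    using assms by (intro product_group) (simp add: comm_group_def)
  fix y z assume "y \<in> carrier (product_group I H)" "z \<in> carrier (product_group I H)"
  then show "y \<otimes>\<^bsub>product_group I H\<^esub> z = z \<otimes>\<^bsub>product_group I H\<^esub> y"
    using assms by (auto simp: PiE_iff comm_group_def comm_monoid.m_comm intro!: restrict_ext)
qed

lemma pow_product_group:
  assumes "\<And>i. i \<in> I \<Longrightarrow> group (H i)"
  shows "y [^]\<^bsub>product_group I H\<^esub> (e :: nat) = (\<lambda>i\<in>I. y i [^]\<^bsub>H i\<^esub> e)"
proof -
  interpret group "product_group I H" using assms by simp
  have "monoid (H i)" if "i \<in> I" for i using assms[OF that] by (simp add: group.is_monoid)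
  then show ?thesis
    by (induction e) (auto simp: monoid.nat_pow_0 monoid.nat_pow_Suc intro!: restrict_ext)
qed

theorem proposition2p7:
  fixes n :: nat and m :: "nat \<Rightarrow> nat" and x :: "nat \<Rightarrow> int"
    and G :: "(nat \<Rightarrow> int) monoid" and g :: "nat \<Rightarrow> (nat \<Rightarrow> int)"
  assumes "1 \<le> n"
    and "\<And>l. l \<in> {1..n} \<Longrightarrow> 1 \<le> m l"
    and "\<And>l. l \<in> {1..n} \<Longrightarrow> x l \<in> carrier (integer_mod_group (m l))"
    and "\<And>l. l \<in> {1..n} \<Longrightarrow>
           generate (integer_mod_group (m l)) {x l} = carrier (integer_mod_group (m l))"
    and "G = product_group {1..n} (\<lambda>l. integer_mod_group (m l))"
    and "g = (\<lambda>l. \<lambda>k\<in>{1..n}. if k = l then x l else \<one>\<^bsub>integer_mod_group (m k)\<^esub>)"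
  shows "(\<exists>F0 F1 F2 F3. comparison_maps G n m g F0 F1 F2 F3) \<and>
         (\<forall>F0 F1 F2 F3. comparison_maps G n m g F0 F1 F2 F3 \<longrightarrow>
            (\<forall>v \<in> carrier (bar_module G 0). augmentation (F0 v) = augmentation v) \<and>
            (\<forall>v \<in> carrier (bar_module G 1). tensor_d G n m g (F1 v) = F0 (bar_d1 G v)) \<and>
            (\<forall>v \<in> carrier (bar_module G 2). tensor_d G n m g (F2 v) = F1 (bar_d2 G v)) \<and>
            (\<forall>v \<in> carrier (bar_module G 3). tensor_d G n m g (F3 v) = F2 (bar_d3 G v)))"
proof -
  interpret G: comm_group G
    unfolding assms(5) by (rule comm_group_product_group) simp
  have g_closed: "g l \<in> carrier G" for l
    unfolding assms(5,6) using assms(3) by auto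
  have gpow: "g l [^]\<^bsub>G\<^esub> e = (\<lambda>k\<in>{1..n}. (int e * (if k = l then x l else 0)) mod int (m k))"
    for l and e :: nat
    unfolding assms(5) by (subst pow_product_group) (auto simp: assms(6) intro!: restrict_ext)
  \<comment> \<open>Stated for every prefix to allow induction: coordinates above \<open>p\<close>
    are still 0, and the factor at \<open>Suc p\<close> changes only its own coordinate.\<close>
  have "gmon G g p e = (\<lambda>k\<in>{1..n}. if k \<le> p then (int (e k) * x k) mod int (m k) else 0)" for p e
  proof (induction p)
    case 0
    show ?case unfolding G.gmon_0 by (auto simp: assms(5) intro!: restrict_ext)
  next
    case (Suc p)
    then show ?case
      unfolding G.gmon_Suc[of g, OF g_closed] gpow
      by (auto simp: assms(5) le_Suc_eq intro!: restrict_ext)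
  qed
  then have gmon: "gmon G g n e = (\<lambda>k\<in>{1..n}. (int (e k) * x k) mod int (m k))" for e
    by (auto intro!: restrict_ext)
  interpret cyclic_decomposition G n m g
  proof
    fix l assume l: "l \<in> {1..n}"
    show "0 < m l" using assms(2)[OF l] by simp
    show "g l [^]\<^bsub>G\<^esub> m l = \<one>\<^bsub>G\<^esub>"
      unfolding gpow by (auto simp: assms(5) intro!: restrict_ext)
  next
    fix e e' l
    assume e: "e \<in> exponents n m" "e' \<in> exponents n m" and eq: "gmon G g n e = gmon G g n e'"
      and l: "l \<in> {1..n}"
    have "(int (e l) * x l) mod int (m l) = (int (e' l) * x l) mod int (m l)"
      using fun_cong[OF eq, of l] l unfolding gmon by simp
    then show "e l = e' l"
      using e l integer_mod_group_generator_cancel[OF assms(2-4)[OF l]] by (auto simp: exponents_def)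
  next
    fix h assume h: "h \<in> carrier G"
    \<comment> \<open>Surjectivity is solved in each coordinate separately; the exponents are then
      chosen simultaneously.\<close>
    have "\<exists>c. c < m l \<and> (int c * x l) mod int (m l) = h l" if l: "l \<in> {1..n}" for l
    proof -
      have "h l \<in> carrier (integer_mod_group (m l))" using h l by (auto simp: assms(5))
      then show ?thesis using integer_mod_group_generator_mult[OF assms(2-4)[OF l]] by metis
    qed
    then obtain e where e: "\<And>l. l \<in> {1..n} \<Longrightarrow> e l < m l \<and> (int (e l) * x l) mod int (m l) = h l"
      by metis
    have "gmon G g n e = h"
      unfolding gmon by (rule extensionalityI[of _ "{1..n}"]) (use e h in \<open>auto simp: assms(5) PiE_iff\<close>)
    moreover have "e \<in> exponents n m"
      using e by (simp add: exponents_def)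
    ultimately show "\<exists>e\<in>exponents n m. gmon G g n e = h" by blast
  qed (rule g_closed)
  show ?thesis
    using comparison_maps_exist augmentation_F0 tensor_d_F1 tensor_d_F2 tensor_d_F3 by blast
qed

end
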